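(* Let $K$ be a sufficiently saturated NIP field, possibly with extra structure. Let $\tau$ be a definable ring topology on $K$. Then there is an externally definable proper subring $R \subsetneq K$ with $\operatorname{Frac}(R) = K$, such that $\tau$ is the $R$-adic topology $\tau_R$. We can also arrange for $R$ to be a $K_0$-algebra (i.e., $K_0 \subseteq R$) for some small elementary substructure $K_0 \preceq K$.
   Context: "NIP field, possibly with extra structure" means a first-order structure $(K,+,\cdot,\ldots)$ expanding a field whose complete theory is NIP. A ring topology on $K$ is a Hausdorff, non-discrete topology for which $+,-,\cdot$ are continuous. "Definable" means definable with parameters. A topology on a definable set is definable if some uniformly definable family of sets is a basis of open sets. A subset of $K^m$ is externally definable if it has the form $X \cap K^m$ where $X$ is definable, with parameters, in some elementary extension of $K$. "Sufficiently saturated" means $\kappa$-saturated for some sufficiently large cardinal $\kappa>|L|+\aleph_0$, where $L$ is the language; "small" means of cardinality less than $\kappa$. $R$-adic topology: if $R$ is an integral domain with fraction field $K = \operatorname{Frac}(R) \neq R$, then $\tau_R$ is the ring topology on $K$ for which the non-zero ideals of $R$ form a neighborhood basis of $0$ (equivalently, $\{cR : c \in K^\times\}$ is a neighborhood basis of $0$). *)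

theory Defs
  imports "HOL-Analysis.Analysis"
begin

unbundle cardinal_syntax

section \<open>First-order logic\<close>

text \<open>The symbols of a language are the elements of two types \<open>'f\<close> and \<open>'r\<close>.
  Symbols carry arities; equality is a logical symbol. Terms and formulas that respect the
  arities are singled out by \<open>wf_tm\<close> and \<open>wf_fm\<close>.\<close>

record ('f, 'r) language =
  farity :: "'f \<Rightarrow> nat"
  rarity :: "'r \<Rightarrow> nat"

datatype 'f tm = Var nat | Fun 'f "'f tm list"

datatype ('f, 'r) fm =
    Eq "'f tm" "'f tm"
  | Rel 'r "'f tm list"
  | Neg "('f, 'r) fm"
  | Conj "('f, 'r) fm" "('f, 'r) fm"
  | Exi nat "('f, 'r) fm"

fun wf_tm :: "('f, 'r) language \<Rightarrow> 'f tm \<Rightarrow> bool" where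
  "wf_tm L (Var i) = True"
| "wf_tm L (Fun f ts) = (length ts = farity L f \<and> (\<forall>t\<in>set ts. wf_tm L t))"

fun wf_fm :: "('f, 'r) language \<Rightarrow> ('f, 'r) fm \<Rightarrow> bool" where
  "wf_fm L (Eq s t) = (wf_tm L s \<and> wf_tm L t)"
| "wf_fm L (Rel r ts) = (length ts = rarity L r \<and> (\<forall>t\<in>set ts. wf_tm L t))"
| "wf_fm L (Neg \<phi>) = wf_fm L \<phi>"
| "wf_fm L (Conj \<phi> \<psi>) = (wf_fm L \<phi> \<and> wf_fm L \<psi>)"
| "wf_fm L (Exi i \<phi>) = wf_fm L \<phi>"

fun fv_tm :: "'f tm \<Rightarrow> nat set" where
  "fv_tm (Var i) = {i}"
| "fv_tm (Fun f ts) = (\<Union>t\<in>set ts. fv_tm t)"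

fun fv_fm :: "('f, 'r) fm \<Rightarrow> nat set" where
  "fv_fm (Eq s t) = fv_tm s \<union> fv_tm t"
| "fv_fm (Rel r ts) = (\<Union>t\<in>set ts. fv_tm t)"
| "fv_fm (Neg \<phi>) = fv_fm \<phi>"
| "fv_fm (Conj \<phi> \<psi>) = fv_fm \<phi> \<union> fv_fm \<psi>"
| "fv_fm (Exi i \<phi>) = fv_fm \<phi> - {i}"

record ('a, 'f, 'r) struc =
  univ :: "'a set"
  fint :: "'f \<Rightarrow> 'a list \<Rightarrow> 'a"
  rint :: "'r \<Rightarrow> 'a list \<Rightarrow> bool"

definition tuples :: "nat \<Rightarrow> 'a set \<Rightarrow> 'a list set" where
  "tuples m A = {xs. length xs = m \<and> set xs \<subseteq> A}"

definition is_struc :: "('f, 'r) language \<Rightarrow> ('a, 'f, 'r) struc \<Rightarrow> bool" where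
  "is_struc L M \<longleftrightarrow>
     univ M \<noteq> {} \<and> (\<forall>f. \<forall>xs\<in>tuples (farity L f) (univ M). fint M f xs \<in> univ M)"

fun tm_val :: "('a, 'f, 'r) struc \<Rightarrow> (nat \<Rightarrow> 'a) \<Rightarrow> 'f tm \<Rightarrow> 'a" where
  "tm_val M e (Var i) = e i"
| "tm_val M e (Fun f ts) = fint M f (map (tm_val M e) ts)"

fun sat :: "('a, 'f, 'r) struc \<Rightarrow> (nat \<Rightarrow> 'a) \<Rightarrow> ('f, 'r) fm \<Rightarrow> bool" where
  "sat M e (Eq s t) = (tm_val M e s = tm_val M e t)"
| "sat M e (Rel r ts) = rint M r (map (tm_val M e) ts)"
| "sat M e (Neg \<phi>) = (\<not> sat M e \<phi>)"
| "sat M e (Conj \<phi> \<psi>) = (sat M e \<phi> \<and> sat M e \<psi>)"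
| "sat M e (Exi i \<phi>) = (\<exists>a\<in>univ M. sat M (e(i := a)) \<phi>)"

section \<open>Elementary embeddings\<close>

definition elementary_embedding ::
    "('f, 'r) language \<Rightarrow> ('a \<Rightarrow> 'b) \<Rightarrow> ('a, 'f, 'r) struc \<Rightarrow> ('b, 'f, 'r) struc \<Rightarrow> bool" where
  "elementary_embedding L h M N \<longleftrightarrow>
     is_struc L M \<and> is_struc L N \<and> h ` univ M \<subseteq> univ N \<and>
     (\<forall>\<phi> e. wf_fm L \<phi> \<longrightarrow> range e \<subseteq> univ M \<longrightarrow> (sat N (h \<circ> e) \<phi> \<longleftrightarrow> sat M e \<phi>))"

text \<open>Agreement of the function and relation symbols on the smaller universe is the case of
  atomic formulas.\<close>

definition elementary_substruc ::
    "('f, 'r) language \<Rightarrow> ('a, 'f, 'r) struc \<Rightarrow> ('a, 'f, 'r) struc \<Rightarrow> bool" where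
  "elementary_substruc L M N \<longleftrightarrow> elementary_embedding L id M N"

section \<open>Definable and externally definable sets\<close>

text \<open>In a formula \<open>\<phi>(x; y)\<close> with \<open>x\<close> an \<open>m\<close>-tuple, the variables
  \<open>0, \<dots>, m - 1\<close> play the role of \<open>x\<close> and all other variables that of \<open>y\<close>. An
  \<open>m\<close>-tuple \<open>xs\<close> overwrites the first \<open>m\<close> values of an assignment \<open>e\<close>; the remaining
  values of \<open>e\<close> at free variables, finitely many, are the parameters.\<close>

definition asg :: "'a list \<Rightarrow> (nat \<Rightarrow> 'a) \<Rightarrow> nat \<Rightarrow> 'a" where
  "asg xs e i = (if i < length xs then xs ! i else e i)"

definition definable ::
    "('f, 'r) language \<Rightarrow> ('a, 'f, 'r) struc \<Rightarrow> nat \<Rightarrow> 'a list set \<Rightarrow> bool" where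
  "definable L M m X \<longleftrightarrow>
     (\<exists>\<phi> e. wf_fm L \<phi> \<and> range e \<subseteq> univ M \<and> X = {xs \<in> tuples m (univ M). sat M (asg xs e) \<phi>})"

text \<open>HOL cannot quantify existentially over types, so the elementary extension is taken on
  subsets of the type \<open>'a + 'f + 'r + nat\<close>, up to isomorphism (hence the embedding \<open>h\<close>).
  This loses nothing: by the downward Loewenheim-Skolem theorem, a set \<open>X\<close> definable with
  parameters \<open>b\<close> in an arbitrary elementary extension of \<open>M\<close> has the same trace on \<open>M\<close> as
  the set given by the same formula in an elementary substructure containing \<open>M\<close> and \<open>b\<close>
  of cardinality at most that of \<open>'a + 'f + 'r + nat\<close>.\<close>

definition externally_definable ::
    "('f, 'r) language \<Rightarrow> ('a, 'f, 'r) struc \<Rightarrow> nat \<Rightarrow> 'a list set \<Rightarrow> bool" where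
  "externally_definable L M m X \<longleftrightarrow>
     (\<exists>(N :: ('a + 'f + 'r + nat, 'f, 'r) struc) h Y.
        elementary_embedding L h M N \<and> definable L N m Y \<and>
        X = {xs \<in> tuples m (univ M). map h xs \<in> Y})"

definition uniformly_definable_family ::
    "('f, 'r) language \<Rightarrow> ('a, 'f, 'r) struc \<Rightarrow> 'a set set \<Rightarrow> bool" where
  "uniformly_definable_family L M \<B> \<longleftrightarrow>
     (\<exists>n Y Z. definable L M n Y \<and> definable L M (Suc n) Z \<and>
        \<B> = (\<lambda>ys. {x. x # ys \<in> Z}) ` Y)"

definition definable_topology ::
    "('f, 'r) language \<Rightarrow> ('a, 'f, 'r) struc \<Rightarrow> 'a topology \<Rightarrow> bool" where
  "definable_topology L M \<tau> \<longleftrightarrow>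
     topspace \<tau> = univ M \<and>
     (\<exists>\<B>. uniformly_definable_family L M \<B> \<and> openin \<tau> = arbitrary union_of (\<lambda>U. U \<in> \<B>))"

section \<open>NIP and saturation\<close>

text \<open>A formula \<open>\<phi>(x; y)\<close> has IP if it shatters finite sets of \<open>x\<close>-tuples of every size.
  For each fixed size this is expressed by a first-order sentence, so it can be tested in a single
  model and depends only on the complete theory of \<open>M\<close>.\<close>

definition has_IP ::
    "('a, 'f, 'r) struc \<Rightarrow> nat \<Rightarrow> ('f, 'r) fm \<Rightarrow> bool" where
  "has_IP M m \<phi> \<longleftrightarrow>
     (\<forall>n. \<exists>A \<subseteq> tuples m (univ M). finite A \<and> card A = n \<and>
        (\<forall>S \<subseteq> A. \<exists>e. range e \<subseteq> univ M \<and> {xs \<in> A. sat M (asg xs e) \<phi>} = S))"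

definition NIP :: "('f, 'r) language \<Rightarrow> ('a, 'f, 'r) struc \<Rightarrow> bool" where
  "NIP L M \<longleftrightarrow> (\<forall>m \<phi>. wf_fm L \<phi> \<longrightarrow> \<not> has_IP M m \<phi>)"

text \<open>A pair \<open>(\<phi>, e)\<close> stands for the formula \<open>\<phi>\<close> in which the free variables from \<open>m\<close>
  on are replaced by the parameters given by \<open>e\<close>; these are required to lie in \<open>A\<close>.\<close>

definition partial_type ::
    "('f, 'r) language \<Rightarrow> ('a, 'f, 'r) struc \<Rightarrow> nat \<Rightarrow> 'a set
     \<Rightarrow> (('f, 'r) fm \<times> (nat \<Rightarrow> 'a)) set \<Rightarrow> bool" where
  "partial_type L M m A p \<longleftrightarrow>
     (\<forall>(\<phi>, e)\<in>p. wf_fm L \<phi> \<and> range e \<subseteq> univ M \<and> e ` (fv_fm \<phi> - {..<m}) \<subseteq> A) \<and>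
     (\<forall>q \<subseteq> p. finite q \<longrightarrow>
        (\<exists>xs\<in>tuples m (univ M). \<forall>(\<phi>, e)\<in>q. sat M (asg xs e) \<phi>))"

definition saturated ::
    "('f, 'r) language \<Rightarrow> ('a, 'f, 'r) struc \<Rightarrow> 'k rel \<Rightarrow> bool" where
  "saturated L M \<kappa> \<longleftrightarrow>
     (\<forall>m A p. A \<subseteq> univ M \<longrightarrow> |A| <o \<kappa> \<longrightarrow> partial_type L M m A p \<longrightarrow>
        (\<exists>xs\<in>tuples m (univ M). \<forall>(\<phi>, e)\<in>p. sat M (asg xs e) \<phi>))"

section \<open>Fields with extra structure, ring topologies\<close>

definition expands_field ::
    "('f, 'r) language \<Rightarrow> 'f \<Rightarrow> 'f \<Rightarrow> ('a :: field, 'f, 'r) struc \<Rightarrow> bool" where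
  "expands_field L plus_sym times_sym K \<longleftrightarrow>
     is_struc L K \<and> univ K = UNIV \<and>
     farity L plus_sym = 2 \<and> (\<forall>x y. fint K plus_sym [x, y] = x + y) \<and>
     farity L times_sym = 2 \<and> (\<forall>x y. fint K times_sym [x, y] = x * y)"

definition ring_topology :: "'a :: field topology \<Rightarrow> bool" where
  "ring_topology \<tau> \<longleftrightarrow>
     topspace \<tau> = UNIV \<and> Hausdorff_space \<tau> \<and> \<tau> \<noteq> discrete_topology UNIV \<and>
     continuous_map (prod_topology \<tau> \<tau>) \<tau> (\<lambda>(x, y). x + y) \<and>
     continuous_map (prod_topology \<tau> \<tau>) \<tau> (\<lambda>(x, y). x - y) \<and>
     continuous_map (prod_topology \<tau> \<tau>) \<tau> (\<lambda>(x, y). x * y)"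

definition is_subring :: "'a :: field set \<Rightarrow> bool" where
  "is_subring R \<longleftrightarrow> 0 \<in> R \<and> 1 \<in> R \<and> (\<forall>x\<in>R. \<forall>y\<in>R. x + y \<in> R \<and> x - y \<in> R \<and> x * y \<in> R)"

definition frac_eq_UNIV :: "'a :: field set \<Rightarrow> bool" where
  "frac_eq_UNIV R \<longleftrightarrow> (\<forall>x. \<exists>a\<in>R. \<exists>b\<in>R. b \<noteq> 0 \<and> x = a / b)"

definition is_ideal :: "'a :: field set \<Rightarrow> 'a set \<Rightarrow> bool" where
  "is_ideal R I \<longleftrightarrow>
     I \<subseteq> R \<and> 0 \<in> I \<and> (\<forall>x\<in>I. \<forall>y\<in>I. x + y \<in> I) \<and> (\<forall>r\<in>R. \<forall>x\<in>I. r * x \<in> I)"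

text \<open>A ring topology is determined by a neighbourhood basis of \<open>0\<close>, so for a subring \<open>R\<close>
  there is at most one \<open>\<tau>\<close> with the following property.\<close>

definition is_adic_topology :: "'a :: field set \<Rightarrow> 'a topology \<Rightarrow> bool" where
  "is_adic_topology R \<tau> \<longleftrightarrow>
     ring_topology \<tau> \<and>
     (\<forall>I. is_ideal R I \<and> I \<noteq> {0} \<longrightarrow> (\<exists>U. openin \<tau> U \<and> 0 \<in> U \<and> U \<subseteq> I)) \<and>
     (\<forall>U. openin \<tau> U \<and> 0 \<in> U \<longrightarrow> (\<exists>I. is_ideal R I \<and> I \<noteq> {0} \<and> I \<subseteq> U))"

end

theory Submission
  imports Defs
begin

text \<open>
  Fix a definable basis \<open>U\<^sub>y\<close>, \<open>y \<in> Y\<close>, of neighbourhoods of \<open>0\<close>. For a small elementary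
  substructure \<open>S\<close> over which the basis is defined, let \<open>J\<^sub>S\<close> be the intersection of the \<open>U\<^sub>b\<close>
  with \<open>b\<close> a point of \<open>S\<close>; these are the infinitesimals over \<open>S\<close>. Elementarity of \<open>S\<close> transfers
  the axioms of a ring topology to the neighbourhoods indexed by points of \<open>S\<close>, so \<open>J\<^sub>S\<close> is
  closed under addition and multiplication, and saturation puts some \<open>U\<^sub>y\<close> inside \<open>J\<^sub>S\<close>. The
  ring will be the set \<open>R\<^sub>S\<close> of all \<open>x\<close> that act continuously for the neighbourhoods indexed by
  \<open>S\<close>: for each \<open>b\<close> in \<open>S\<close> there is \<open>c\<close> in \<open>S\<close> with \<open>x U\<^sub>c \<subseteq> U\<^sub>b\<close>. It contains \<open>S\<close> and
  \<open>J\<^sub>S\<close>, and it maps \<open>J\<^sub>S\<close> to itself. Since \<open>J\<^sub>S\<close> is a neighbourhood of \<open>0\<close> that omits \<open>1\<close>,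
  the ring is proper with fraction field \<open>K\<close>, and each of its non-zero ideals is a
  neighbourhood of \<open>0\<close> (\<open>subbasis_points\<close>, \<open>stabilizer_subring\<close>, \<open>stabilizer_proper\<close>,
  \<open>stabilizer_frac\<close>, \<open>nbhd_in_ideal\<close>).

  For \<open>\<tau>\<close> to be the \<open>R\<^sub>S\<close>-adic topology it remains that every \<open>U\<^sub>b\<close> contains some \<open>c J\<^sub>S\<close>
  with \<open>c \<noteq> 0\<close>. This is where NIP enters. If \<open>b\<close> lies in \<open>S' \<supseteq> S\<close> then \<open>J\<^sub>S\<^sub>' \<subseteq> U\<^sub>b\<close>, so it
  suffices to find one \<open>S\<close> such that \<open>J\<^sub>S\<^sub>'\<close> contains a non-zero multiple of \<open>J\<^sub>S\<close> for all
  \<open>S' \<supseteq> S\<close>. If there is none, there is an infinite chain of structures \<open>S\<^sub>i\<close> such that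
  \<open>J\<^sub>i\<^sub>+\<^sub>1\<close> contains no non-zero multiple of \<open>J\<^sub>i\<close>. Scaled copies \<open>D\<^sub>k = {x. c\<^sub>k x \<in> J\<^sub>k\<^sub>+\<^sub>1}\<close> of
  the members of the chain then form an independent family of additive groups, with points
  \<open>x\<^sub>i\<close> that lie in every \<open>D\<^sub>k\<close> except \<open>D\<^sub>i\<close> (\<open>independent_points\<close>). As in the
  Baldwin--Saxl lemma, the sum of the \<open>x\<^sub>i\<close> with \<open>i \<in> T\<close> lies in exactly those \<open>D\<^sub>k\<close> with
  \<open>k \<notin> T\<close>. On finitely many points each \<open>D\<^sub>k\<close> agrees with a set \<open>{x. c\<^sub>k x \<in> U\<^sub>b}\<close>, so the
  formula \<open>c x \<in> U\<^sub>b\<close> has IP (\<open>chain_shatters\<close>, \<open>NIP_not_shatters\<close>, \<open>stable_small_model\<close>).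

  External definability of \<open>R\<^sub>S\<close> is a coheir argument: choose an ultrafilter on pairs
  \<open>(z, y)\<close> of indices in \<open>S\<close> along which \<open>U\<^sub>z\<close> becomes infinitesimal, and \<open>U\<^sub>y\<close> infinitesimal
  even relative to \<open>z\<close>. Then \<open>x\<close> is in \<open>R\<^sub>S\<close> if and only if \<open>x U\<^sub>y \<subseteq> U\<^sub>z\<close> along the
  ultrafilter (\<open>stabilizer_ultrafilter\<close>). By the theorem of Los, such a condition is a
  formula in \<open>x\<close> with one tuple of parameters in the ultrapower. The downward Loewenheim--Skolem
  theorem replaces the ultrapower by an elementary extension that is small enough
  (\<open>externally_definable_ultrafilter\<close>), and also provides the structures \<open>S\<close>.
\<close>

section \<open>Renaming variables\<close>

lemma finite_fv_tm: "finite (fv_tm t)"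
  by (induction t) auto

lemma finite_fv_fm: "finite (fv_fm \<phi>)"
  by (induction \<phi>) (auto simp: finite_fv_tm)

lemma tm_val_cong:
  "(\<And>i. i \<in> fv_tm t \<Longrightarrow> e i = e' i) \<Longrightarrow> tm_val M e t = tm_val M e' t"
proof (induction t)
  case (Fun f ts)
  then have "map (tm_val M e) ts = map (tm_val M e') ts" by auto
  then show ?case by (simp del: map_eq_conv)
qed auto

lemma sat_cong:
  "(\<And>i. i \<in> fv_fm \<phi> \<Longrightarrow> e i = e' i) \<Longrightarrow> sat M e \<phi> = sat M e' \<phi>"
proof (induction \<phi> arbitrary: e e')
  case (Eq s t)
  then have "tm_val M e s = tm_val M e' s" "tm_val M e t = tm_val M e' t"
    by (auto intro: tm_val_cong)
  then show ?case by simp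
next
  case (Rel r ts)
  have "map (tm_val M e) ts = map (tm_val M e') ts"
    using Rel by (auto intro: tm_val_cong)
  then show ?case by (simp del: map_eq_conv)
next
  case (Neg \<phi>)
  have "sat M e \<phi> = sat M e' \<phi>" using Neg.prems by (intro Neg.IH) simp
  then show ?case by simp
next
  case (Conj \<phi> \<psi>)
  have "sat M e \<phi> = sat M e' \<phi>" using Conj.prems by (intro Conj.IH(1)) auto
  moreover have "sat M e \<psi> = sat M e' \<psi>" using Conj.prems by (intro Conj.IH(2)) auto
  ultimately show ?case by simp
next
  case (Exi i \<phi>)
  have "sat M (e(i := a)) \<phi> = sat M (e'(i := a)) \<phi>" for a
    using Exi.prems by (intro Exi.IH) auto
  then show ?case by simp
qed

fun ren_tm :: "(nat \<Rightarrow> nat) \<Rightarrow> 'f tm \<Rightarrow> 'f tm" where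
  "ren_tm \<rho> (Var i) = Var (\<rho> i)"
| "ren_tm \<rho> (Fun f ts) = Fun f (map (ren_tm \<rho>) ts)"

definition fresh :: "nat set \<Rightarrow> nat" where
  "fresh V = Suc (Max (insert 0 V))"

lemma fresh_notin: "finite V \<Longrightarrow> i \<in> V \<Longrightarrow> i \<noteq> fresh V"
proof
  assume V: "finite V" "i \<in> V" "i = fresh V"
  then have "i \<le> Max (insert 0 V)" by (intro Max_ge) auto
  then show False using V(3) by (simp add: fresh_def)
qed

text \<open>Renaming must not capture variables, so bound variables are renamed to ones outside the image
  of the free variables.\<close>

primrec ren :: "(nat \<Rightarrow> nat) \<Rightarrow> ('f, 'r) fm \<Rightarrow> ('f, 'r) fm" where
  "ren \<rho> (Eq s t) = Eq (ren_tm \<rho> s) (ren_tm \<rho> t)"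
| "ren \<rho> (Rel r ts) = Rel r (map (ren_tm \<rho>) ts)"
| "ren \<rho> (Neg \<phi>) = Neg (ren \<rho> \<phi>)"
| "ren \<rho> (Conj \<phi> \<psi>) = Conj (ren \<rho> \<phi>) (ren \<rho> \<psi>)"
| "ren \<rho> (Exi i \<phi>) =
     Exi (fresh (\<rho> ` fv_fm \<phi>)) (ren (\<rho>(i := fresh (\<rho> ` fv_fm \<phi>))) \<phi>)"

lemma wf_ren_tm [simp]: "wf_tm L (ren_tm \<rho> t) = wf_tm L t"
  by (induction t) auto

lemma wf_ren [simp]: "wf_fm L (ren \<rho> \<phi>) = wf_fm L \<phi>"
  by (induction \<phi> arbitrary: \<rho>) auto

lemma tm_val_ren_tm: "tm_val M e (ren_tm \<rho> t) = tm_val M (e \<circ> \<rho>) t"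
  by (induction t) (auto intro!: arg_cong[where f = "fint M _"])

lemma sat_ren: "sat M e (ren \<rho> \<phi>) = sat M (e \<circ> \<rho>) \<phi>"
proof (induction \<phi> arbitrary: e \<rho>)
  case (Rel r ts)
  have "map (tm_val M e \<circ> ren_tm \<rho>) ts = map (tm_val M (e \<circ> \<rho>)) ts"
    by (auto simp: tm_val_ren_tm)
  then show ?case by (simp del: map_eq_conv comp_apply)
next
  case (Exi i \<phi>)
  define j where "j = fresh (\<rho> ` fv_fm \<phi>)"
  have *: "sat M (e(j := a) \<circ> \<rho>(i := j)) \<phi> = sat M ((e \<circ> \<rho>)(i := a)) \<phi>" for a
  proof (rule sat_cong)
    fix k assume "k \<in> fv_fm \<phi>"
    then have "\<rho> k \<noteq> j"
      using fresh_notin[of "\<rho> ` fv_fm \<phi>" "\<rho> k"] by (auto simp: finite_fv_fm j_def)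
    then show "(e(j := a) \<circ> \<rho>(i := j)) k = ((e \<circ> \<rho>)(i := a)) k" by auto
  qed
  then show ?case by (simp only: ren.simps sat.simps Exi.IH j_def[symmetric] *)
qed (simp_all add: tm_val_ren_tm)

section \<open>Predicates definable over a set of parameters\<close>

text \<open>A table \<open>\<sigma>\<close> assigns to each variable of a formula either a variable of the surrounding
  assignment or a constant.\<close>

definition pval :: "(nat \<Rightarrow> nat + 'a) \<Rightarrow> (nat \<Rightarrow> 'a) \<Rightarrow> nat \<Rightarrow> 'a" where
  "pval \<sigma> e i = (case \<sigma> i of Inl j \<Rightarrow> e j | Inr a \<Rightarrow> a)"

text \<open>Definability is handled as a property of predicates on assignments. This gives closure under
  logical operations and changes of variables without writing any formula. The constants sit
  in the table \<open>\<sigma>\<close> and not in the assignment, so that they survive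
  quantification and substitution.\<close>

definition dpred ::
    "('f, 'r) language \<Rightarrow> ('a, 'f, 'r) struc \<Rightarrow> 'a set \<Rightarrow> ((nat \<Rightarrow> 'a) \<Rightarrow> bool) \<Rightarrow> bool" where
  "dpred L M A P \<longleftrightarrow>
     (\<exists>\<phi> \<sigma>. wf_fm L \<phi> \<and> range \<sigma> \<subseteq> range Inl \<union> Inr ` A \<and> P = (\<lambda>e. sat M (pval \<sigma> e) \<phi>))"

lemma dpredI:
  assumes "wf_fm L \<phi>" "range \<sigma> \<subseteq> range Inl \<union> Inr ` A"
  shows "dpred L M A (\<lambda>e. sat M (pval \<sigma> e) \<phi>)"
  using assms unfolding dpred_def by blast

lemma dpred_sat:
  assumes "wf_fm L \<phi>"
  shows "dpred L M A (\<lambda>e. sat M e \<phi>)"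
proof -
  have "dpred L M A (\<lambda>e. sat M (pval Inl e) \<phi>)"
    by (rule dpredI[OF assms]) auto
  then show ?thesis by (simp add: pval_def[abs_def])
qed

lemma dpred_subst:
  assumes "dpred L M A P" "range \<theta> \<subseteq> range Inl \<union> Inr ` A"
  shows "dpred L M A (\<lambda>e. P (pval \<theta> e))"
proof -
  obtain \<phi> \<sigma> where *: "wf_fm L \<phi>" "range \<sigma> \<subseteq> range Inl \<union> Inr ` A"
    "P = (\<lambda>e. sat M (pval \<sigma> e) \<phi>)"
    using assms(1) unfolding dpred_def by blast
  define \<sigma>' where "\<sigma>' i = (case \<sigma> i of Inl j \<Rightarrow> \<theta> j | Inr a \<Rightarrow> Inr a)" for i
  have "\<sigma>' i \<in> range Inl \<union> Inr ` A" for i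
  proof (cases "\<sigma> i")
    case (Inl j)
    then show ?thesis using assms(2) by (simp only: \<sigma>'_def sum.case) blast
  next
    case (Inr a)
    moreover have "\<sigma> i \<in> range Inl \<union> Inr ` A" using *(2) by blast
    ultimately show ?thesis by (auto simp: \<sigma>'_def)
  qed
  moreover have "pval \<sigma> (pval \<theta> e) = pval \<sigma>' e" for e
    by (auto simp: pval_def \<sigma>'_def fun_eq_iff split: sum.splits)
  ultimately show ?thesis
    using dpredI[OF *(1), of \<sigma>' A M] *(3) by auto
qed

lemma dpred_ren: "dpred L M A P \<Longrightarrow> dpred L M A (\<lambda>e. P (\<lambda>i. e (\<rho> i)))"
  using dpred_subst[of L M A P "\<lambda>i. Inl (\<rho> i)"] by (auto simp: pval_def[abs_def])

lemma dpred_not: "dpred L M A P \<Longrightarrow> dpred L M A (\<lambda>e. \<not> P e)"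
proof -
  assume "dpred L M A P"
  then obtain \<phi> \<sigma> where *: "wf_fm L \<phi>" "range \<sigma> \<subseteq> range Inl \<union> Inr ` A"
    "P = (\<lambda>e. sat M (pval \<sigma> e) \<phi>)"
    unfolding dpred_def by blast
  then show ?thesis using dpredI[of L "Neg \<phi>" \<sigma> A M] by simp
qed

text \<open>Two formulas bring their own tables of parameters; the even variables are used for the first
  and the odd ones for the second.\<close>

lemma dpred_conj:
  assumes "dpred L M A P" "dpred L M A Q"
  shows "dpred L M A (\<lambda>e. P e \<and> Q e)"
proof -
  obtain \<phi> \<sigma> where *: "wf_fm L \<phi>" "range \<sigma> \<subseteq> range Inl \<union> Inr ` A"
    "P = (\<lambda>e. sat M (pval \<sigma> e) \<phi>)"
    using assms unfolding dpred_def by blast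
  obtain \<psi> \<theta> where **: "wf_fm L \<psi>" "range \<theta> \<subseteq> range Inl \<union> Inr ` A"
    "Q = (\<lambda>e. sat M (pval \<theta> e) \<psi>)"
    using assms unfolding dpred_def by blast
  define \<eta> where "\<eta> i = (if even i then \<sigma> (i div 2) else \<theta> (i div 2))" for i
  have "range \<eta> \<subseteq> range Inl \<union> Inr ` A"
  proof (rule image_subsetI)
    fix i
    have "\<sigma> (i div 2) \<in> range Inl \<union> Inr ` A" "\<theta> (i div 2) \<in> range Inl \<union> Inr ` A"
      using *(2) **(2) by blast+
    then show "\<eta> i \<in> range Inl \<union> Inr ` A" by (simp only: \<eta>_def split: if_split) simp
  qed
  moreover have even: "pval \<eta> e \<circ> (\<lambda>i. 2 * i) = pval \<sigma> e"
    and odd: "pval \<eta> e \<circ> (\<lambda>i. Suc (2 * i)) = pval \<theta> e" for e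
    by (auto simp: \<eta>_def pval_def fun_eq_iff)
  have "(\<lambda>e. P e \<and> Q e) =
    (\<lambda>e. sat M (pval \<eta> e) (Conj (ren (\<lambda>i. 2 * i) \<phi>) (ren (\<lambda>i. Suc (2 * i)) \<psi>)))"
    by (simp only: *(3) **(3) sat.simps sat_ren even odd)
  ultimately show ?thesis
    using *(1) **(1) by (simp only:) (rule dpredI, simp_all)
qed

lemma dpred_imp:
  assumes "dpred L M A P" "dpred L M A Q"
  shows "dpred L M A (\<lambda>e. P e \<longrightarrow> Q e)"
  using dpred_not[OF dpred_conj[OF assms(1) dpred_not[OF assms(2)]]] by simp

text \<open>Quantifiers are introduced in de Bruijn style: nested quantifiers then need no
  choice of variable names, and freshness conditions do not arise.\<close>

lemma dpred_ex:
  fixes M :: "('a, 'f, 'r) struc"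
  assumes "dpred L M A (\<lambda>e. P (e 0) (\<lambda>i. e (Suc i)))"
  shows "dpred L M A (\<lambda>e. \<exists>a\<in>univ M. P a e)"
proof -
  obtain \<phi> \<sigma> where *: "wf_fm L \<phi>" "range \<sigma> \<subseteq> range Inl \<union> Inr ` A"
    "(\<lambda>e. P (e 0) (\<lambda>i. e (Suc i))) = (\<lambda>e. sat M (pval \<sigma> e) \<phi>)"
    using assms unfolding dpred_def by blast
  define \<rho> where "\<rho> i = (if \<sigma> i = Inl 0 then 0 else Suc i)" for i
  define \<theta> :: "nat \<Rightarrow> nat + 'a" where
    "\<theta> i = (case i of 0 \<Rightarrow> Inl 0 | Suc k \<Rightarrow>
       (case \<sigma> k of Inl 0 \<Rightarrow> Inl 0 | Inl (Suc j) \<Rightarrow> Inl j | Inr a \<Rightarrow> Inr a))" for i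
  have "\<theta> i \<in> range Inl \<union> Inr ` A" for i
  proof (cases i)
    case (Suc k)
    have "\<sigma> k \<in> range Inl \<union> Inr ` A" using *(2) by blast
    then show ?thesis using Suc by (auto simp: \<theta>_def split: nat.splits)
  qed (simp add: \<theta>_def)
  moreover have "P a e \<longleftrightarrow> sat M ((pval \<theta> e)(0 := a)) (ren \<rho> \<phi>)" for a e
  proof -
    let ?e = "\<lambda>i. case i of 0 \<Rightarrow> a | Suc k \<Rightarrow> e k"
    have "P a e \<longleftrightarrow> P (?e 0) (\<lambda>i. ?e (Suc i))" by simp
    also have "\<dots> \<longleftrightarrow> sat M (pval \<sigma> ?e) \<phi>" using fun_cong[OF *(3), of ?e] by simp
    also have "pval \<sigma> ?e = (pval \<theta> e)(0 := a) \<circ> \<rho>"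
      by (auto simp: \<rho>_def \<theta>_def pval_def fun_eq_iff split: sum.splits nat.splits)
    finally show ?thesis by (simp only: sat_ren)
  qed
  ultimately show ?thesis
    using dpredI[of L "Exi 0 (ren \<rho> \<phi>)" \<theta> A M] *(1) by (auto simp: image_subset_iff)
qed

lemma dpred_all:
  assumes "dpred L M A (\<lambda>e. P (e 0) (\<lambda>i. e (Suc i)))"
  shows "dpred L M A (\<lambda>e. \<forall>a\<in>univ M. P a e)"
  using dpred_not[OF dpred_ex[of L M A "\<lambda>a e. \<not> P a e", OF dpred_not[OF assms]]] by simp

text \<open>The form required by types, externally definable sets and the definition of IP: the first
  \<open>m\<close> variables are the object variables, and all parameters are values of an assignment. Variables
  and constants other than the first \<open>m\<close> variables become variables from \<open>m\<close> on.\<close>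

lemma dpred_normal_form:
  assumes "dpred L M A P"
  obtains \<phi> T where "wf_fm L \<phi>" "\<And>e. range (T e) \<subseteq> A \<union> range e"
    "\<And>e xs. length xs = m \<Longrightarrow> P (asg xs e) \<longleftrightarrow> sat M (asg xs (T e)) \<phi>"
proof -
  obtain \<phi> \<sigma> where *: "wf_fm L \<phi>" "range \<sigma> \<subseteq> range Inl \<union> Inr ` A"
    "P = (\<lambda>e. sat M (pval \<sigma> e) \<phi>)"
    using assms unfolding dpred_def by blast
  define \<rho> where "\<rho> i = (case \<sigma> i of Inl j \<Rightarrow> if j < m then j else m + i | Inr a \<Rightarrow> m + i)" for i
  define T where "T e k = pval \<sigma> e (k - m)" for e k
  have "range (T e) \<subseteq> A \<union> range e" for e
  proof
    fix x assume "x \<in> range (T e)"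
    then obtain k where k: "x = pval \<sigma> e (k - m)" by (auto simp: T_def)
    have "\<sigma> (k - m) \<in> range Inl \<union> Inr ` A" using *(2) by blast
    then show "x \<in> A \<union> range e" by (auto simp: k pval_def)
  qed
  moreover have "P (asg xs e) \<longleftrightarrow> sat M (asg xs (T e)) (ren \<rho> \<phi>)" if "length xs = m" for e xs
  proof -
    have "pval \<sigma> (asg xs e) = asg xs (T e) \<circ> \<rho>"
      using that by (auto simp: pval_def asg_def \<rho>_def T_def fun_eq_iff split: sum.splits)
    then show ?thesis by (simp add: *(3) sat_ren)
  qed
  ultimately show ?thesis using that[of "ren \<rho> \<phi>" T] *(1) by simp
qed

section \<open>Elementary substructures\<close>

definition tarski_vaught :: "('f, 'r) language \<Rightarrow> ('a, 'f, 'r) struc \<Rightarrow> 'a set \<Rightarrow> bool" where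
  "tarski_vaught L M S \<longleftrightarrow> S \<noteq> {} \<and> S \<subseteq> univ M \<and>
     (\<forall>\<phi> e i. wf_fm L \<phi> \<longrightarrow> range e \<subseteq> S \<longrightarrow> (\<exists>a\<in>univ M. sat M (e(i := a)) \<phi>)
        \<longrightarrow> (\<exists>a\<in>S. sat M (e(i := a)) \<phi>))"

lemma tm_val_univ_upd: "tm_val (M\<lparr>univ := S\<rparr>) e t = tm_val M e t"
  by (induction t) (auto intro!: arg_cong[where f = "fint M _"])

lemma tarski_vaught_sat:
  assumes "tarski_vaught L M S" "wf_fm L \<phi>" "range e \<subseteq> S"
  shows "sat (M\<lparr>univ := S\<rparr>) e \<phi> \<longleftrightarrow> sat M e \<phi>"
  using assms(2,3)
proof (induction \<phi> arbitrary: e)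
  case (Rel r ts)
  have "map (tm_val (M\<lparr>univ := S\<rparr>) e) ts = map (tm_val M e) ts" by (simp add: tm_val_univ_upd)
  then show ?case by (simp del: map_eq_conv)
next
  case (Exi i \<phi>)
  have "sat (M\<lparr>univ := S\<rparr>) (e(i := a)) \<phi> \<longleftrightarrow> sat M (e(i := a)) \<phi>" if "a \<in> S" for a
    using that Exi.prems by (intro Exi.IH) auto
  moreover have "S \<subseteq> univ M" using assms(1) by (simp add: tarski_vaught_def)
  moreover have "(\<exists>a\<in>univ M. sat M (e(i := a)) \<phi>) \<longrightarrow> (\<exists>a\<in>S. sat M (e(i := a)) \<phi>)"
    using assms(1) Exi.prems by (simp add: tarski_vaught_def)
  ultimately show ?case by auto
qed (auto simp: tm_val_univ_upd)

lemma tarski_vaught_fint: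
  fixes L :: "('f, 'r) language"
  assumes M: "is_struc L M" and S: "tarski_vaught L M S" and xs: "xs \<in> tuples (farity L f) S"
  shows "fint M f xs \<in> S"
proof -
  obtain s where s: "s \<in> S" using S by (auto simp: tarski_vaught_def)
  define e where "e = asg (s # xs) (\<lambda>_. s)"
  define \<phi> :: "('f, 'r) fm" where "\<phi> = Eq (Var 0) (Fun f (map Var [1..<Suc (length xs)]))"
  have "wf_fm L \<phi>" using xs by (auto simp: \<phi>_def tuples_def)
  moreover have "range e \<subseteq> S"
  proof
    fix y assume "y \<in> range e"
    then obtain i where i: "y = e i" by blast
    show "y \<in> S"
      using s xs nth_mem[of i "s # xs"] by (auto simp: i e_def asg_def tuples_def simp del: nth_mem)
  qed
  moreover have sat: "sat M (e(0 := a)) \<phi> \<longleftrightarrow> a = fint M f xs" for a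
  proof -
    have "map (tm_val M (e(0 := a)) \<circ> Var) [1..<Suc (length xs)] = xs"
      by (rule nth_equalityI) (auto simp: e_def asg_def simp del: upt_Suc)
    then show ?thesis by (simp add: \<phi>_def del: upt_Suc)
  qed
  moreover have "fint M f xs \<in> univ M"
    using M S xs by (auto simp: is_struc_def tarski_vaught_def tuples_def)
  ultimately have "\<exists>a\<in>S. sat M (e(0 := a)) \<phi>"
    using S unfolding tarski_vaught_def by blast
  then show ?thesis by (simp add: sat)
qed

lemma tarski_vaught_elementary:
  assumes "is_struc L M" "tarski_vaught L M S"
  shows "elementary_substruc L (M\<lparr>univ := S\<rparr>) M"
proof -
  have "is_struc L (M\<lparr>univ := S\<rparr>)"
    using tarski_vaught_fint[OF assms] assms(2) by (auto simp: is_struc_def tarski_vaught_def)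
  moreover have "S \<subseteq> univ M" using assms(2) by (simp add: tarski_vaught_def)
  ultimately show ?thesis
    using tarski_vaught_sat[OF assms(2)] assms(1)
    by (auto simp: elementary_substruc_def elementary_embedding_def)
qed

text \<open>In the criterion the parameters are the values of an assignment. Here they also occur in the
  table of a definable predicate, so both are first merged into one assignment in which
  variable \<open>0\<close> is reserved for the witness.\<close>

lemma tarski_vaught_dpred:
  assumes "tarski_vaught L M S" "dpred L M S P" "range e \<subseteq> S" "a \<in> univ M" "P (e(i := a))"
  shows "\<exists>a\<in>S. P (e(i := a))"
proof -
  obtain \<phi> \<sigma> where *: "wf_fm L \<phi>" "range \<sigma> \<subseteq> range Inl \<union> Inr ` S"
    "P = (\<lambda>e. sat M (pval \<sigma> e) \<phi>)"
    using assms unfolding dpred_def by blast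
  define \<rho> where "\<rho> k = (if \<sigma> k = Inl i then 0 else Suc k)" for k
  obtain s where s: "s \<in> S" using assms(1) by (auto simp: tarski_vaught_def)
  define d where "d k = (case k of 0 \<Rightarrow> s | Suc k \<Rightarrow> pval \<sigma> e k)" for k
  have P: "P (e(i := a)) \<longleftrightarrow> sat M (d(0 := a)) (ren \<rho> \<phi>)" for a
  proof -
    have "pval \<sigma> (e(i := a)) = d(0 := a) \<circ> \<rho>"
      by (auto simp: pval_def \<rho>_def d_def fun_eq_iff split: sum.splits)
    then show ?thesis by (simp add: *(3) sat_ren)
  qed
  have "pval \<sigma> e k \<in> S" for k
  proof -
    have "\<sigma> k \<in> range Inl \<union> Inr ` S" using *(2) by blast
    then show ?thesis using assms(3) by (auto simp: pval_def)
  qed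
  then have "range d \<subseteq> S" using s by (auto simp: d_def split: nat.splits)
  moreover have "wf_fm L (ren \<rho> \<phi>)" using *(1) by simp
  ultimately show ?thesis
    using assms(1,4,5) unfolding P tarski_vaught_def by blast
qed

lemma asg_upd: "length ys = n \<Longrightarrow> (asg ys e)(n := y) = asg (ys @ [y]) e"
  by (auto simp: asg_def fun_eq_iff nth_append)

lemma range_asg: "set ys \<subseteq> S \<Longrightarrow> range e \<subseteq> S \<Longrightarrow> range (asg ys e) \<subseteq> S"
  by (auto simp: asg_def dest: nth_mem)

lemma dpred_ex_upd:
  fixes M :: "('a, 'f, 'r) struc"
  assumes "dpred L M A P"
  shows "dpred L M A (\<lambda>e. \<exists>a\<in>univ M. P (e(n := a)))"
proof -
  define \<rho> where "\<rho> i = (if i = n then 0 else Suc i)" for i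
  have "dpred L M A (\<lambda>e. P (\<lambda>i. e (\<rho> i)))" by (rule dpred_ren[OF assms])
  moreover have "(\<lambda>i. e (\<rho> i)) = (\<lambda>i. e (Suc i))(n := e 0)" for e :: "nat \<Rightarrow> 'a"
    by (auto simp: \<rho>_def)
  ultimately show ?thesis by (intro dpred_ex) (simp only:)
qed

text \<open>Witnesses are found for one coordinate at a time, starting with the last.\<close>

lemma tarski_vaught_tuple:
  assumes "tarski_vaught L M S" "dpred L M S P" "range e \<subseteq> S"
    and "\<exists>ys\<in>tuples n (univ M). P (asg ys e)"
  shows "\<exists>ys\<in>tuples n S. P (asg ys e)"
  using assms(2,4)
proof (induction n arbitrary: P)
  case 0
  then show ?case by (auto simp: tuples_def)
next
  case (Suc n)
  define Q where "Q e \<longleftrightarrow> (\<exists>a\<in>univ M. P (e(n := a)))" for e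
  have "dpred L M S Q" using dpred_ex_upd[OF Suc.prems(1), of n] by (simp only: Q_def[abs_def])
  moreover have "\<exists>ys\<in>tuples n (univ M). Q (asg ys e)"
  proof -
    obtain zs where zs: "zs \<in> tuples (Suc n) (univ M)" "P (asg zs e)" using Suc.prems by blast
    obtain ys y where ys: "zs = ys @ [y]" "length ys = n"
      using zs(1) by (cases zs rule: rev_cases) (auto simp: tuples_def)
    then have "Q (asg ys e)"
      unfolding Q_def using zs by (intro bexI[of _ y]) (auto simp: asg_upd tuples_def)
    then show ?thesis
      using zs ys by (intro bexI[of _ ys]) (auto simp: tuples_def)
  qed
  ultimately obtain ys where ys: "ys \<in> tuples n S" "Q (asg ys e)" using Suc.IH by blast
  then obtain x where "x \<in> univ M" "P ((asg ys e)(n := x))" unfolding Q_def by blast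
  moreover have "range (asg ys e) \<subseteq> S"
    using ys(1) assms(3) by (intro range_asg) (auto simp: tuples_def)
  ultimately obtain y where "y \<in> S" "P ((asg ys e)(n := y))"
    using tarski_vaught_dpred[OF assms(1) Suc.prems(1)] by blast
  then show ?case
    using ys(1) by (intro bexI[of _ "ys @ [y]"]) (auto simp: asg_upd tuples_def)
qed

section \<open>Cardinality of generated sets\<close>

text \<open>Terms, formulas and Skolem hulls are all generated from a set by finitary operations, which
  bounds their cardinalities in the same way.\<close>

inductive_set generated :: "'b set \<Rightarrow> ('c \<Rightarrow> 'b list \<Rightarrow> 'b) \<Rightarrow> 'b set"
  for A :: "'b set" and g :: "'c \<Rightarrow> 'b list \<Rightarrow> 'b" where
  base: "a \<in> A \<Longrightarrow> a \<in> generated A g"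
| step: "xs \<in> lists (generated A g) \<Longrightarrow> g c xs \<in> generated A g"

lemma card_finite_le: "infinite B \<Longrightarrow> finite A \<Longrightarrow> |A| \<le>o |B|"
  by (intro ordLess_imp_ordLeq finite_ordLess_infinite)
    (auto simp: Field_card_of card_of_well_order_on)

lemma card_Un_le: "infinite B \<Longrightarrow> |A| \<le>o |B| \<Longrightarrow> |C| \<le>o |B| \<Longrightarrow> |A \<union> C| \<le>o |B|"
  by (rule card_of_Un_ordLeq_infinite_Field) (simp_all add: Field_card_of card_of_card_order_on)

lemma card_lists_le:
  assumes inf: "infinite (B :: 'd set)" and A: "|A| \<le>o |B|"
  shows "|lists A| \<le>o |B|"
proof -
  define l where "l n = {xs \<in> lists A. length xs = n}" for n
  have "|l n| \<le>o |B|" for n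
  proof (induction n)
    case 0
    have "finite (l 0)" by (rule finite_subset[of _ "{[]}"]) (auto simp: l_def)
    then show ?case using inf by (intro card_finite_le)
  next
    case (Suc n)
    have "l (Suc n) \<subseteq> (\<lambda>(x, xs). x # xs) ` (A \<times> l n)"
      by (auto simp: l_def length_Suc_conv)
    then have "|l (Suc n)| \<le>o |A \<times> l n|"
      using card_of_image ordLeq_transitive card_of_mono1 by blast
    also have "|A \<times> l n| \<le>o |B|"
      using inf A Suc.IH by (intro card_of_Sigma_ordLeq_infinite) auto
    finally show ?case .
  qed
  moreover have "|UNIV :: nat set| \<le>o |B|" using inf infinite_iff_card_of_nat by blast
  ultimately have "|\<Union>n. l n| \<le>o |B|"
    using inf by (intro card_of_UNION_ordLeq_infinite) auto
  moreover have "(\<Union>n. l n) = lists A" by (auto simp: l_def)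
  ultimately show ?thesis by simp
qed

text \<open>Closing a set once under the operations does not increase an infinite cardinal bound, and
  \<open>\<omega>\<close> such steps exhaust the generated set.\<close>

lemma card_generated_le:
  fixes g :: "'c \<Rightarrow> 'b list \<Rightarrow> 'b"
  assumes inf: "infinite (B :: 'd set)" and A: "|A| \<le>o |B|" and C: "|UNIV :: 'c set| \<le>o |B|"
  shows "|generated A g| \<le>o |B|"
proof -
  define s where "s = rec_nat A (\<lambda>_ X. X \<union> case_prod g ` (UNIV \<times> lists X))"
  have s0: "s 0 = A" and sS: "s (Suc n) = s n \<union> case_prod g ` (UNIV \<times> lists (s n))" for n
    by (simp_all add: s_def)
  have card: "|s n| \<le>o |B|" for n
  proof (induction n)
    case (Suc n)
    have "|UNIV \<times> lists (s n) :: ('c \<times> 'b list) set| \<le>o |B|"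
      using inf C card_lists_le[OF inf Suc.IH] by (intro card_of_Sigma_ordLeq_infinite) auto
    then have "|case_prod g ` (UNIV \<times> lists (s n))| \<le>o |B|"
      using card_of_image ordLeq_transitive by blast
    then show ?case using Suc.IH inf 
      unfolding sS by (intro card_Un_le)
  qed (simp add: s0 A)
  have mono: "s m \<subseteq> s n" if "m \<le> n" for m n
    using that by (induction rule: dec_induct) (auto simp: sS)
  have "x \<in> (\<Union>n. s n)" if "x \<in> generated A g" for x
    using that
  proof induction
    case (base a)
    then show ?case using s0 by blast
  next
    case (step xs c)
    have *: "\<exists>n. set ys \<subseteq> s n" if "set ys \<subseteq> (\<Union>n. s n)" for ys
      using that
    proof (induction ys)
      case (Cons y ys)
      then obtain m n where "y \<in> s m" "set ys \<subseteq> s n" by auto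
      then have "set (y # ys) \<subseteq> s (max m n)" using mono[of m "max m n"] mono[of n "max m n"] by auto
      then show ?case by blast
    qed simp
    have "set xs \<subseteq> (\<Union>n. s n)" using step by auto
    then obtain n where "set xs \<subseteq> s n" using * by blast
    then have "g c xs \<in> s (Suc n)" by (auto simp: sS intro!: image_eqI[of _ _ "(c, xs)"])
    then show ?case by blast
  qed
  then have "generated A g \<subseteq> (\<Union>n. s n)" by blast
  moreover have "|UNIV :: nat set| \<le>o |B|" using inf infinite_iff_card_of_nat by blast
  then have "|\<Union>n. s n| \<le>o |B|"
    using inf card by (intro card_of_UNION_ordLeq_infinite) auto
  ultimately show ?thesis using card_of_mono1 ordLeq_transitive by blast
qed

lemma card_sum_le:
  assumes "infinite (B :: 'd set)" "|UNIV :: 'a set| \<le>o |B|" "|UNIV :: 'b set| \<le>o |B|"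
  shows "|UNIV :: ('a + 'b) set| \<le>o |B|"
  using assms card_of_Plus_ordLeq_infinite_Field[of "|B|" "UNIV :: 'a set" "UNIV :: 'b set"]
  by (simp add: Field_card_of card_of_card_order_on)

lemma card_le_inj:
  fixes f :: "'a \<Rightarrow> 'b"
  assumes "inj f" "|UNIV :: 'b set| \<le>o |B|"
  shows "|UNIV :: 'a set| \<le>o |B|"
proof -
  have "|UNIV :: 'a set| \<le>o |UNIV :: 'b set|" using assms(1) card_of_ordLeq[of UNIV UNIV] by auto
  then show ?thesis using assms(2) ordLeq_transitive by blast
qed

lemma card_tm_le:
  assumes "infinite (B :: 'd set)" "|UNIV :: 'f set| \<le>o |B|"
  shows "|UNIV :: 'f tm set| \<le>o |B|"
proof -
  have "t \<in> generated (range Var) Fun" for t :: "'f tm"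
  proof (induction t)
    case (Fun f ts)
    then have "ts \<in> lists (generated (range Var) Fun)" by blast
    then show ?case by (rule generated.step)
  qed (auto intro: generated.base)
  then have "(UNIV :: 'f tm set) = generated (range Var) Fun" by blast
  moreover have "|range Var :: 'f tm set| \<le>o |B|"
    using card_of_image[of Var UNIV] infinite_iff_card_of_nat assms(1) ordLeq_transitive by blast
  ultimately show ?thesis using card_generated_le assms by metis
qed

lemma card_fm_le:
  assumes inf: "infinite (B :: 'd set)" and B: "|UNIV :: ('f + 'r + nat) set| \<le>o |B|"
  shows "|UNIV :: ('f, 'r) fm set| \<le>o |B|"
proof -
  \<comment> \<open>one operation for each connective, with \<open>Inr i\<close> for the quantifier over variable \<open>i\<close>\<close>
  define g :: "bool + nat \<Rightarrow> ('f, 'r) fm list \<Rightarrow> ('f, 'r) fm" where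
    "g c xs = (case c of Inl b \<Rightarrow> if b then Neg (hd xs) else Conj (hd xs) (hd (tl xs))
                | Inr i \<Rightarrow> Exi i (hd xs))" for c xs
  have g: "g (Inl True) [\<phi>] = Neg \<phi>" "g (Inl False) [\<phi>, \<psi>] = Conj \<phi> \<psi>" "g (Inr i) [\<phi>] = Exi i \<phi>"
    for \<phi> \<psi> i by (simp_all add: g_def)
  define A :: "('f, 'r) fm set" where
    "A = range (case_prod Eq) \<union> case_prod Rel ` (UNIV \<times> lists UNIV)"
  have f: "|UNIV :: 'f set| \<le>o |B|" by (rule card_le_inj[OF _ B, of Inl]) simp
  have r: "|UNIV :: 'r set| \<le>o |B|" by (rule card_le_inj[OF _ B, of "Inr \<circ> Inl"]) (simp add: inj_compose)
  have tm: "|UNIV :: 'f tm set| \<le>o |B|" by (rule card_tm_le[OF inf f])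
  have "\<phi> \<in> generated A g" for \<phi> :: "('f, 'r) fm"
  proof (induction \<phi>)
    case (Eq s t)
    then show ?case by (intro generated.base) (auto simp: A_def)
  next
    case (Rel p ts)
    then show ?case by (intro generated.base) (auto simp: A_def)
  next
    case (Neg \<phi>)
    then have "g (Inl True) [\<phi>] \<in> generated A g" by (intro generated.step) simp
    then show ?case by (simp add: g)
  next
    case (Conj \<phi> \<psi>)
    then have "g (Inl False) [\<phi>, \<psi>] \<in> generated A g" by (intro generated.step) simp
    then show ?case by (simp add: g)
  next
    case (Exi i \<phi>)
    then have "g (Inr i) [\<phi>] \<in> generated A g" by (intro generated.step) simp
    then show ?case by (simp add: g)
  qed
  then have "(UNIV :: ('f, 'r) fm set) = generated A g" by blast
  moreover have "|A| \<le>o |B|"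
  proof -
    have "|UNIV :: ('f tm \<times> 'f tm) set| \<le>o |B|"
      using inf tm card_of_Sigma_ordLeq_infinite[of B "UNIV :: 'f tm set" "\<lambda>_. UNIV :: 'f tm set"]
      by simp
    then have "|range (case_prod Eq) :: ('f, 'r) fm set| \<le>o |B|"
      using card_of_image ordLeq_transitive by blast
    moreover have "|UNIV \<times> lists UNIV :: ('r \<times> 'f tm list) set| \<le>o |B|"
      using inf r card_lists_le[OF inf tm] by (intro card_of_Sigma_ordLeq_infinite) auto
    then have "|case_prod Rel ` (UNIV \<times> lists UNIV) :: ('f, 'r) fm set| \<le>o |B|"
      using card_of_image ordLeq_transitive by blast
    ultimately show ?thesis using inf unfolding A_def by (intro card_Un_le)
  qed
  moreover have "|UNIV :: (bool + nat) set| \<le>o |B|"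
  proof (rule card_sum_le[OF inf])
    show "|UNIV :: nat set| \<le>o |B|" using inf infinite_iff_card_of_nat by blast
    show "|UNIV :: bool set| \<le>o |B|"
      using inf by (intro card_finite_le) simp_all
  qed
  ultimately show ?thesis using card_generated_le[OF inf] by metis
qed

section \<open>The downward Loewenheim--Skolem theorem\<close>

text \<open>The set is generated by \<open>A\<close> and a choice of witnesses, where a list of values for the first
  variables stands for an assignment.\<close>

theorem downward_loewenheim_skolem:
  fixes M :: "('b, 'f, 'r) struc"
  assumes A: "A \<subseteq> univ M" "A \<noteq> {}" and inf: "infinite (B :: 'd set)"
    and cA: "|A| \<le>o |B|" and cL: "|UNIV :: ('f + 'r + nat) set| \<le>o |B|"
  shows "\<exists>S. A \<subseteq> S \<and> |S| \<le>o |B| \<and> tarski_vaught L M S"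
proof -
  obtain d where d: "d \<in> A" using A by blast
  define w :: "(('f, 'r) fm \<times> nat) \<Rightarrow> 'b list \<Rightarrow> 'b" where
    "w c xs = (if \<exists>a\<in>univ M. sat M ((asg xs (\<lambda>_. d))(snd c := a)) (fst c)
       then SOME a. a \<in> univ M \<and> sat M ((asg xs (\<lambda>_. d))(snd c := a)) (fst c) else d)" for c xs
  define S where "S = generated A w"
  have w: "w c xs \<in> univ M \<and> ((\<exists>a\<in>univ M. sat M ((asg xs (\<lambda>_. d))(snd c := a)) (fst c)) \<longrightarrow>
      sat M ((asg xs (\<lambda>_. d))(snd c := w c xs)) (fst c))" for c xs
  proof (cases "\<exists>a\<in>univ M. sat M ((asg xs (\<lambda>_. d))(snd c := a)) (fst c)")
    case True
    then have "\<exists>a. a \<in> univ M \<and> sat M ((asg xs (\<lambda>_. d))(snd c := a)) (fst c)" by blast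
    from someI_ex[OF this] show ?thesis using True by (simp only: w_def if_True) blast
  next
    case False
    then show ?thesis using d A by (auto simp only: w_def if_False)
  qed
  have "x \<in> univ M" if "x \<in> S" for x
    using that unfolding S_def by induction (use A w in auto)
  then have sub: "S \<subseteq> univ M" by blast
  have AS: "A \<subseteq> S" by (auto simp: S_def intro: generated.base)
  have "\<exists>a\<in>S. sat M (e(i := a)) \<phi>"
    if e: "range e \<subseteq> S" and ex: "\<exists>a\<in>univ M. sat M (e(i := a)) \<phi>" for \<phi> e i
  proof -
    define N where "N = fresh (fv_fm \<phi>)"
    define xs where "xs = map e [0..<N]"
    have "k < N" if "k \<in> fv_fm \<phi>" for k
      using that finite_fv_fm[of \<phi>] Max_ge[of "insert 0 (fv_fm \<phi>)" k]
      by (auto simp: N_def fresh_def less_Suc_eq_le)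
    then have eq: "sat M ((asg xs (\<lambda>_. d))(i := a)) \<phi> = sat M (e(i := a)) \<phi>" for a
      by (intro sat_cong) (auto simp: xs_def asg_def)
    have "w (\<phi>, i) xs \<in> S" unfolding S_def
      using e by (intro generated.step) (auto simp: xs_def S_def image_subset_iff)
    then show ?thesis using w[of "(\<phi>, i)" xs] ex by (auto simp only: eq fst_conv snd_conv)
  qed
  then have "tarski_vaught L M S" using AS A sub by (auto simp: tarski_vaught_def)
  moreover have "|S| \<le>o |B|" unfolding S_def
  proof (rule card_generated_le[OF inf cA])
    have "|UNIV :: nat set| \<le>o |B|" using inf infinite_iff_card_of_nat by blast
    then show "|UNIV :: (('f, 'r) fm \<times> nat) set| \<le>o |B|"
      using inf card_fm_le[OF inf cL]
        card_of_Sigma_ordLeq_infinite[of B "UNIV :: ('f, 'r) fm set" "\<lambda>_. UNIV :: nat set"]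
      by simp
  qed
  ultimately show ?thesis using AS by blast
qed

section \<open>Ultrafilters and ultrapowers\<close>

definition ultrafilter :: "'i filter \<Rightarrow> bool" where
  "ultrafilter F \<longleftrightarrow> F \<noteq> bot \<and> (\<forall>P. eventually P F \<or> eventually (\<lambda>x. \<not> P x) F)"

lemma ultrafilter_not:
  "ultrafilter F \<Longrightarrow> eventually (\<lambda>x. \<not> P x) F \<longleftrightarrow> \<not> eventually P F"
  unfolding ultrafilter_def using eventually_elim2[of P F "\<lambda>x. \<not> P x" "\<lambda>_. False"]
  by (auto simp: trivial_limit_def)

lemma ultrafilter_refines:
  assumes "F \<noteq> bot"
  obtains G where "G \<le> F" "ultrafilter G"
proof -
  let ?A = "{G. G \<le> F \<and> G \<noteq> bot}"
  have "\<exists>m\<in>?A. \<forall>a\<in>?A. a \<le> m \<longrightarrow> a = m"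
  proof (rule predicate_Zorn[of ?A "\<lambda>x y. y \<le> x"])
    show "partial_order_on ?A (relation_of (\<lambda>x y. y \<le> x) ?A)"
      by (rule partial_order_on_relation_ofI) auto
    fix C assume C: "C \<in> Chains (relation_of (\<lambda>x y. y \<le> x) ?A)"
    show "\<exists>u\<in>?A. \<forall>a\<in>C. u \<le> a"
    proof (cases "C = {}")
      case False
      have CA: "C \<subseteq> ?A" using C by (auto simp: Chains_def relation_of_def)
      have "eventually P (Inf C) \<longleftrightarrow> (\<exists>b\<in>C. eventually P b)" for P
      proof (rule eventually_Inf_base[OF False])
        fix x y assume "x \<in> C" "y \<in> C"
        then have "x \<le> y \<or> y \<le> x" using C by (auto simp: Chains_def relation_of_def)
        then show "\<exists>z\<in>C. z \<le> inf x y"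
        proof
          assume "x \<le> y"
          then show ?thesis using \<open>x \<in> C\<close> by (intro bexI[of _ x]) simp_all
        next
          assume "y \<le> x"
          then show ?thesis using \<open>y \<in> C\<close> by (intro bexI[of _ y]) simp_all
        qed
      qed
      from this[of "\<lambda>_. False"] have "Inf C \<noteq> bot"
        using CA by (auto simp: trivial_limit_def)
      moreover obtain c where "c \<in> C" using False by blast
      then have "Inf C \<le> F" using CA Inf_lower[of c C] by (auto intro: order_trans)
      ultimately show ?thesis by (intro bexI[of _ "Inf C"]) (auto intro: Inf_lower)
    qed (use assms in auto)
  qed
  then obtain G where G: "G \<le> F" "G \<noteq> bot" "\<And>H. H \<le> F \<Longrightarrow> H \<noteq> bot \<Longrightarrow> H \<le> G \<Longrightarrow> H = G"
    by auto
  have "eventually P G \<or> eventually (\<lambda>x. \<not> P x) G" for P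
  proof (cases "inf G (principal {x. P x}) = bot")
    case True
    then show ?thesis by (simp add: trivial_limit_def eventually_inf_principal)
  next
    case False
    have "inf G (principal {x. P x}) = G"
      using False G(1) by (intro G(3)) (auto intro: le_infI1)
    moreover have "eventually P (inf G (principal {x. P x}))"
      by (simp add: eventually_inf_principal)
    ultimately show ?thesis by simp
  qed
  then show ?thesis using that G by (auto simp: ultrafilter_def)
qed

text \<open>Elements of the ultrapower are functions on the index type; a chosen function represents each
  class of functions that agree almost everywhere.\<close>

definition rep :: "'i filter \<Rightarrow> ('i \<Rightarrow> 'a) \<Rightarrow> 'i \<Rightarrow> 'a" where
  "rep F f = (SOME g. eventually (\<lambda>i. g i = f i) F)"

lemma rep_eventually: "eventually (\<lambda>i. rep F f i = f i) F"
  unfolding rep_def by (rule someI[where x = f]) simp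

lemma rep_eq_iff: "rep F f = rep F g \<longleftrightarrow> eventually (\<lambda>i. f i = g i) F"
proof
  assume "rep F f = rep F g"
  then show "eventually (\<lambda>i. f i = g i) F"
    using rep_eventually[of F f] rep_eventually[of F g] by (auto elim: eventually_elim2)
next
  assume *: "eventually (\<lambda>i. f i = g i) F"
  have "eventually (\<lambda>i. h i = f i) F \<longleftrightarrow> eventually (\<lambda>i. h i = g i) F" for h
    using * by (auto elim: eventually_elim2)
  then show "rep F f = rep F g" by (simp add: rep_def)
qed

lemma rep_range: "f \<in> range (rep F) \<Longrightarrow> rep F f = f"
  by (auto simp: rep_eq_iff rep_eventually)

definition ultrapower :: "'i filter \<Rightarrow> ('a, 'f, 'r) struc \<Rightarrow> ('i \<Rightarrow> 'a, 'f, 'r) struc" where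
  "ultrapower F M =
     \<lparr>univ = range (rep F),
      fint = (\<lambda>f xs. rep F (\<lambda>i. fint M f (map (\<lambda>g. g i) xs))),
      rint = (\<lambda>r xs. eventually (\<lambda>i. rint M r (map (\<lambda>g. g i) xs)) F)\<rparr>"

lemma ultrapower_tm_val:
  "eventually (\<lambda>i. tm_val (ultrapower F M) e t i = tm_val M (\<lambda>v. e v i) t) F"
proof (induction t)
  case (Fun f ts)
  then have "eventually (\<lambda>i. \<forall>t\<in>set ts. tm_val (ultrapower F M) e t i = tm_val M (\<lambda>v. e v i) t) F"
    by (intro eventually_ball_finite) auto
  moreover have "eventually (\<lambda>i. tm_val (ultrapower F M) e (Fun f ts) i =
      fint M f (map (\<lambda>g. g i) (map (tm_val (ultrapower F M) e) ts))) F"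
    using rep_eventually by (simp add: ultrapower_def)
  ultimately show ?case
  proof eventually_elim
    case (elim i)
    have "map (\<lambda>g. g i) (map (tm_val (ultrapower F M) e) ts) = map (tm_val M (\<lambda>v. e v i)) ts"
      using elim(1) by auto
    then show ?case using elim(2) by (simp only: tm_val.simps)
  qed
qed simp

lemma ultrapower_tm_val_range:
  "range e \<subseteq> range (rep F) \<Longrightarrow> tm_val (ultrapower F M) e t \<in> range (rep F)"
  by (cases t) (auto simp: ultrapower_def)

theorem los:
  fixes M :: "('a, 'f, 'r) struc" and F :: "'i filter"
  assumes F: "ultrafilter F" and M: "univ M = UNIV" and e: "range e \<subseteq> range (rep F)"
  shows "sat (ultrapower F M) e \<phi> \<longleftrightarrow> eventually (\<lambda>i. sat M (\<lambda>v. e v i) \<phi>) F"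
  using e
proof (induction \<phi> arbitrary: e)
  case (Eq s t)
  let ?v = "tm_val (ultrapower F M) e"
  have "?v s = ?v t \<longleftrightarrow> eventually (\<lambda>i. ?v s i = ?v t i) F"
    using rep_eq_iff[of F "?v s" "?v t"]
    by (simp only: rep_range[OF ultrapower_tm_val_range[OF Eq]])
  also have "\<dots> \<longleftrightarrow> eventually (\<lambda>i. tm_val M (\<lambda>v. e v i) s = tm_val M (\<lambda>v. e v i) t) F"
    using ultrapower_tm_val[of F M e s] ultrapower_tm_val[of F M e t]
    by (intro eventually_subst) (auto elim: eventually_elim2)
  finally show ?case by simp
next
  case (Rel r ts)
  have "eventually (\<lambda>i. \<forall>t\<in>set ts. tm_val (ultrapower F M) e t i = tm_val M (\<lambda>v. e v i) t) F"
    by (intro eventually_ball_finite) (auto simp: ultrapower_tm_val)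
  then have "eventually (\<lambda>i. rint M r (map (\<lambda>g. g i) (map (tm_val (ultrapower F M) e) ts)) =
      rint M r (map (tm_val M (\<lambda>v. e v i)) ts)) F"
  proof eventually_elim
    case (elim i)
    have "map (\<lambda>g. g i) (map (tm_val (ultrapower F M) e) ts) = map (tm_val M (\<lambda>v. e v i)) ts"
      using elim by auto
    then show ?case by (simp only:)
  qed
  then show ?case using eventually_subst
    by (simp only: sat.simps ultrapower_def struc.simps) (rule eventually_subst, simp)
next
  case (Neg \<phi>)
  then show ?case by (simp add: ultrafilter_not[OF F])
next
  case (Conj \<phi> \<psi>)
  then show ?case by (simp add: eventually_conj_iff)
next
  case (Exi j \<phi>)
  have IH: "sat (ultrapower F M) (e(j := g)) \<phi> \<longleftrightarrow>
      eventually (\<lambda>i. sat M ((\<lambda>v. e v i)(j := g i)) \<phi>) F" if "g \<in> range (rep F)" for g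
  proof -
    have "range (e(j := g)) \<subseteq> range (rep F)" using Exi.prems that by auto
    moreover have "(\<lambda>v. (e(j := g)) v i) = (\<lambda>v. e v i)(j := g i)" for i by auto
    ultimately show ?thesis using Exi.IH[of "e(j := g)"] by (simp only:)
  qed
  show ?case
  proof
    assume "sat (ultrapower F M) e (Exi j \<phi>)"
    then obtain g where "g \<in> range (rep F)" "sat (ultrapower F M) (e(j := g)) \<phi>"
      by (auto simp: ultrapower_def)
    then have "eventually (\<lambda>i. sat M ((\<lambda>v. e v i)(j := g i)) \<phi>) F" using IH by blast
    then show "eventually (\<lambda>i. sat M (\<lambda>v. e v i) (Exi j \<phi>)) F"
      by eventually_elim (auto simp: M)
  next
    assume *: "eventually (\<lambda>i. sat M (\<lambda>v. e v i) (Exi j \<phi>)) F"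
    define g where "g i = (SOME a. sat M ((\<lambda>v. e v i)(j := a)) \<phi>)" for i
    have "eventually (\<lambda>i. sat M ((\<lambda>v. e v i)(j := g i)) \<phi>) F"
      using * by eventually_elim (auto simp: g_def M intro: someI_ex)
    then have "eventually (\<lambda>i. sat M ((\<lambda>v. e v i)(j := rep F g i)) \<phi>) F"
      using rep_eventually[of F g] by eventually_elim simp
    then have "sat (ultrapower F M) (e(j := rep F g)) \<phi>" using IH by blast
    then show "sat (ultrapower F M) e (Exi j \<phi>)" by (auto simp: ultrapower_def)
  qed
qed

lemma is_struc_ultrapower: "is_struc L (ultrapower F M)"
  by (auto simp: is_struc_def ultrapower_def)

section \<open>Transporting a structure along an injection\<close>

definition transport :: "('b \<Rightarrow> 'c) \<Rightarrow> ('b, 'f, 'r) struc \<Rightarrow> ('c, 'f, 'r) struc" where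
  "transport j M =
     \<lparr>univ = j ` univ M,
      fint = (\<lambda>f xs. j (fint M f (map (inv_into (univ M) j) xs))),
      rint = (\<lambda>r xs. rint M r (map (inv_into (univ M) j) xs))\<rparr>"

lemma is_struc_transport:
  assumes "inj_on j (univ M)" "is_struc L M"
  shows "is_struc L (transport j M)"
proof -
  have "fint M f (map (inv_into (univ M) j) xs) \<in> univ M"
    if "xs \<in> tuples (farity L f) (j ` univ M)" for f xs
  proof -
    have "map (inv_into (univ M) j) xs \<in> tuples (farity L f) (univ M)"
      using that by (auto simp: tuples_def inv_into_into)
    then show ?thesis using assms(2) by (simp add: is_struc_def)
  qed
  then show ?thesis using assms(2) by (auto simp: is_struc_def transport_def)
qed

lemma transport_tm_val:
  assumes "inj_on j (univ M)" "is_struc L M" "wf_tm L t" "range e \<subseteq> univ M"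
  shows "tm_val M e t \<in> univ M \<and> tm_val (transport j M) (\<lambda>v. j (e v)) t = j (tm_val M e t)"
  using assms(3)
proof (induction t)
  case (Var i)
  then show ?case using assms(4) by auto
next
  case (Fun f ts)
  have vals: "map (tm_val M e) ts \<in> tuples (farity L f) (univ M)"
    using Fun by (auto simp: tuples_def)
  moreover have "map (inv_into (univ M) j) (map (tm_val (transport j M) (\<lambda>v. j (e v))) ts) =
      map (tm_val M e) ts"
    using Fun assms(1) by auto
  ultimately show ?case
    using assms(2) by (simp add: is_struc_def transport_def del: map_map)
qed

lemma transport_sat:
  assumes j: "inj_on j (univ M)" and M: "is_struc L M" and "wf_fm L \<phi>" "range e \<subseteq> univ M"
  shows "sat (transport j M) (\<lambda>v. j (e v)) \<phi> \<longleftrightarrow> sat M e \<phi>"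
  using assms(3,4)
proof (induction \<phi> arbitrary: e)
  case (Eq s t)
  then show ?case using transport_tm_val[OF j M] j
    by (auto simp: inj_on_eq_iff)
next
  case (Rel r ts)
  have "map (inv_into (univ M) j) (map (tm_val (transport j M) (\<lambda>v. j (e v))) ts) =
      map (tm_val M e) ts"
    using transport_tm_val[OF j M, of _ e] j Rel by (auto simp: inv_into_f_f)
  then show ?case by (simp add: transport_def del: map_map)
next
  case (Exi i \<phi>)
  have "sat (transport j M) (((\<lambda>v. j (e v))(i := j a))) \<phi> \<longleftrightarrow> sat M (e(i := a)) \<phi>" if "a \<in> univ M" for a
  proof -
    have "(\<lambda>v. j (e v))(i := j a) = (\<lambda>v. j ((e(i := a)) v))" by auto
    moreover have "wf_fm L \<phi>" "range (e(i := a)) \<subseteq> univ M" using Exi.prems that by auto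
    note Exi.IH[OF this]
    ultimately show ?thesis by (simp only:)
  qed
  moreover have "univ (transport j M) = j ` univ M" by (simp add: transport_def)
  ultimately show ?case by auto
qed auto

section \<open>Ultrafilters give externally definable sets\<close>

text \<open>Along the ultrafilter, the assignments \<open>E i\<close> define one assignment in the ultrapower,
  which supplies the parameters of the external definition. The whole ultrapower may be too large, so
  the elementary extension is a Skolem hull of the image of \<open>M\<close> and these parameters,
  transported to the required type.\<close>

theorem externally_definable_ultrafilter:
  fixes M :: "('a, 'f, 'r) struc" and E :: "'i \<Rightarrow> nat \<Rightarrow> 'a"
  assumes M: "is_struc L M" "univ M = UNIV" and F: "ultrafilter F" and \<phi>: "wf_fm L \<phi>"
  shows "externally_definable L M m {xs. length xs = m \<and> eventually (\<lambda>i. sat M (asg xs (E i)) \<phi>) F}"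
proof -
  let ?B = "UNIV :: ('a + 'f + 'r + nat) set"
  let ?U = "ultrapower F M"
  define c :: "'a \<Rightarrow> 'i \<Rightarrow> 'a" where "c a = rep F (\<lambda>_. a)" for a
  define p where "p k = rep F (\<lambda>i. E i k)" for k
  have cU: "range (rep F) = univ ?U" by (simp add: ultrapower_def)
  have inf: "infinite ?B" by (simp add: infinite_UNIV_char_0)
  have cards: "|UNIV :: 'a set| \<le>o |?B|" "|UNIV :: ('f + 'r + nat) set| \<le>o |?B|"
    using card_le_inj[OF _ ordLeq_refl[OF card_of_Card_order], of Inl]
      card_le_inj[OF _ ordLeq_refl[OF card_of_Card_order], of Inr] by auto
  have "|range c| \<le>o |?B|"
    by (rule ordLeq_transitive[OF card_of_image cards(1)])
  moreover have "|range p| \<le>o |?B|"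
    using card_of_image[of p UNIV] inf infinite_iff_card_of_nat ordLeq_transitive by metis
  ultimately have "|range c \<union> range p| \<le>o |?B|"
    using inf by (intro card_Un_le)
  moreover have "range c \<union> range p \<subseteq> univ ?U" by (auto simp: c_def p_def ultrapower_def)
  ultimately obtain S where S: "range c \<union> range p \<subseteq> S" "|S| \<le>o |?B|" "tarski_vaught L ?U S"
    using downward_loewenheim_skolem[OF _ _ inf _ cards(2), of "range c \<union> range p" ?U L] by blast
  define U' where "U' = ?U\<lparr>univ := S\<rparr>"
  have SU: "S \<subseteq> univ ?U" and univ': "univ U' = S"
    using S(3) by (auto simp: tarski_vaught_def U'_def)
  have U': "is_struc L U'"
    using tarski_vaught_elementary[OF is_struc_ultrapower S(3)]
    by (simp add: U'_def elementary_substruc_def elementary_embedding_def)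
  obtain j :: "('i \<Rightarrow> 'a) \<Rightarrow> 'a + 'f + 'r + nat" where j: "inj_on j (univ U')"
    using S(2) card_of_ordLeq[of S ?B] univ' by auto
  have sat': "sat (transport j U') (\<lambda>v. j (e v)) \<psi> \<longleftrightarrow> eventually (\<lambda>i. sat M (\<lambda>v. e v i) \<psi>) F"
    if "wf_fm L \<psi>" "range e \<subseteq> S" for e \<psi>
  proof -
    have "sat (transport j U') (\<lambda>v. j (e v)) \<psi> \<longleftrightarrow> sat U' e \<psi>"
      using that univ' by (intro transport_sat[OF j U']) auto
    also have "\<dots> \<longleftrightarrow> sat ?U e \<psi>"
      unfolding U'_def by (rule tarski_vaught_sat[OF S(3) that])
    also have "\<dots> \<longleftrightarrow> eventually (\<lambda>i. sat M (\<lambda>v. e v i) \<psi>) F"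
      using that(2) SU cU by (intro los[OF F M(2)]) blast
    finally show ?thesis .
  qed
  have c_ev: "eventually (\<lambda>i. c a i = a) F" for a unfolding c_def by (rule rep_eventually)
  have cS: "c a \<in> S" for a using S(1) by blast
  have "sat (transport j U') ((j \<circ> c) \<circ> e) \<psi> \<longleftrightarrow> sat M e \<psi>" if "wf_fm L \<psi>" for e \<psi>
  proof -
    have fin: "eventually (\<lambda>i. \<forall>k\<in>fv_fm \<psi>. c (e k) i = e k) F"
      by (intro eventually_ball_finite finite_fv_fm) (auto simp: c_ev)
    have "sat (transport j U') (\<lambda>v. j ((c \<circ> e) v)) \<psi> \<longleftrightarrow>
        eventually (\<lambda>i. sat M (\<lambda>v. (c \<circ> e) v i) \<psi>) F"
      using cS by (intro sat' that) auto
    also have "\<dots> \<longleftrightarrow> eventually (\<lambda>i. sat M e \<psi>) F"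
      by (rule eventually_subst, use fin in eventually_elim) (auto intro!: sat_cong)
    also have "\<dots> \<longleftrightarrow> sat M e \<psi>" using F by (simp add: ultrafilter_def)
    finally show ?thesis by (simp add: comp_def)
  qed
  then have emb: "elementary_embedding L (j \<circ> c) M (transport j U')"
    using M is_struc_transport[OF j U'] cS
    by (auto simp: elementary_embedding_def transport_def univ' simp del: comp_apply)
      (auto simp: univ')
  define Y where "Y = {xs \<in> tuples m (univ (transport j U')). sat (transport j U') (asg xs (j \<circ> p)) \<phi>}"
  have "p k \<in> S" for k using S(1) by blast
  then have "range (j \<circ> p) \<subseteq> univ (transport j U')" by (auto simp: transport_def univ')
  then have "definable L (transport j U') m Y" using \<phi> unfolding definable_def Y_def by blast
  moreover have "{xs. length xs = m \<and> eventually (\<lambda>i. sat M (asg xs (E i)) \<phi>) F} =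
      {xs \<in> tuples m (univ M). map (j \<circ> c) xs \<in> Y}"
  proof -
    have "eventually (\<lambda>i. sat M (asg xs (E i)) \<phi>) F \<longleftrightarrow> map (j \<circ> c) xs \<in> Y"
      if "length xs = m" for xs
    proof -
      have eq: "asg (map (j \<circ> c) xs) (j \<circ> p) = (\<lambda>v. j (asg (map c xs) p v))"
        by (auto simp: asg_def fun_eq_iff)
      have fin: "eventually (\<lambda>i. \<forall>k\<in>fv_fm \<phi>. asg (map c xs) p k i = asg xs (E i) k) F"
        by (intro eventually_ball_finite finite_fv_fm)
          (auto simp: asg_def c_ev p_def rep_eventually)
      have "sat (transport j U') (\<lambda>v. j (asg (map c xs) p v)) \<phi> \<longleftrightarrow>
          eventually (\<lambda>i. sat M (\<lambda>v. asg (map c xs) p v i) \<phi>) F"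
        using S(1) by (intro sat' \<phi> range_asg) auto
      also have "\<dots> \<longleftrightarrow> eventually (\<lambda>i. sat M (asg xs (E i)) \<phi>) F"
        by (rule eventually_subst, use fin in eventually_elim) (auto intro!: sat_cong)
      finally have "sat (transport j U') (asg (map (j \<circ> c) xs) (j \<circ> p)) \<phi> \<longleftrightarrow>
          eventually (\<lambda>i. sat M (asg xs (E i)) \<phi>) F" by (simp only: eq)
      moreover have "map (j \<circ> c) xs \<in> tuples m (univ (transport j U'))"
        using that cS by (auto simp: tuples_def transport_def univ')
      ultimately show ?thesis by (simp add: Y_def del: map_map)
    qed
    then show ?thesis by (auto simp: tuples_def M(2))
  qed
  ultimately show ?thesis using emb unfolding externally_definable_def by blast
qed

section \<open>Neighbourhood bases of zero\<close>

locale ring_nbhds =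
  fixes Y :: "'i set" and U :: "'i \<Rightarrow> 'a :: field set"
  assumes zero: "b \<in> Y \<Longrightarrow> 0 \<in> U b"
    and dir: "b \<in> Y \<Longrightarrow> b' \<in> Y \<Longrightarrow> \<exists>c\<in>Y. U c \<subseteq> U b \<inter> U b'"
    and add: "b \<in> Y \<Longrightarrow> \<exists>c\<in>Y. \<forall>u\<in>U c. \<forall>v\<in>U c. u + v \<in> U b"
    and mult: "b \<in> Y \<Longrightarrow> \<exists>c\<in>Y. \<forall>u\<in>U c. \<forall>v\<in>U c. u * v \<in> U b"
    and scale: "b \<in> Y \<Longrightarrow> \<exists>c\<in>Y. \<forall>u\<in>U c. a * u \<in> U b"
    and nonzero: "b \<in> Y \<Longrightarrow> \<exists>u\<in>U b. u \<noteq> 0"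
    and separated: "a \<noteq> 0 \<Longrightarrow> \<exists>b\<in>Y. a \<notin> U b"
begin

lemma Y_nonempty: "Y \<noteq> {}"
  using separated[of 1] by auto

lemma common_nbhd:
  assumes "finite I" "\<And>k. k \<in> I \<Longrightarrow> \<exists>b\<in>Y. \<forall>u\<in>U b. P k u"
  shows "\<exists>b\<in>Y. \<forall>k\<in>I. \<forall>u\<in>U b. P k u"
  using assms
proof (induction I rule: finite_induct)
  case empty
  then show ?case using Y_nonempty by auto
next
  case (insert k I)
  then obtain b b' where "b \<in> Y" "\<forall>k\<in>I. \<forall>u\<in>U b. P k u" "b' \<in> Y" "\<forall>u\<in>U b'. P k u"
    by (metis insertCI)
  then show ?case using dir[of b b'] by blast
qed

text \<open>\<open>Z\<close> stands for the indices of neighbourhoods defined over a small elementary substructure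
  \<open>S\<close>. They satisfy the axioms of a neighbourhood basis among themselves, with scaling by elements
  of \<open>S\<close>. They do not separate points, since they have a common lower
  bound; one of them omits \<open>1\<close>.\<close>

definition subbasis :: "'a set \<Rightarrow> 'i set \<Rightarrow> bool" where
  "subbasis S Z \<longleftrightarrow> Z \<subseteq> Y \<and> -1 \<in> S \<and>
     (\<forall>b\<in>Z. \<forall>b'\<in>Z. \<exists>c\<in>Z. U c \<subseteq> U b \<inter> U b') \<and>
     (\<forall>b\<in>Z. \<exists>c\<in>Z. \<forall>u\<in>U c. \<forall>v\<in>U c. u + v \<in> U b) \<and>
     (\<forall>b\<in>Z. \<exists>c\<in>Z. \<forall>u\<in>U c. \<forall>v\<in>U c. u * v \<in> U b) \<and>
     (\<forall>a\<in>S. \<forall>b\<in>Z. \<exists>c\<in>Z. \<forall>u\<in>U c. a * u \<in> U b) \<and>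
     (\<exists>b\<in>Z. 1 \<notin> U b) \<and> (\<exists>y\<in>Y. \<forall>b\<in>Z. U y \<subseteq> U b)"

definition infinitesimals :: "'i set \<Rightarrow> 'a set" where
  "infinitesimals Z = (\<Inter>b\<in>Z. U b)"

text \<open>The scalars that act continuously for the topology with neighbourhood basis \<open>Z\<close> of \<open>0\<close>.
  Under saturation this is the multiplier ring of the infinitesimals, but in this form it is a
  statement about members of \<open>Z\<close> alone, which is what the external definition needs.\<close>

definition stabilizer :: "'i set \<Rightarrow> 'a set" where
  "stabilizer Z = {x. \<forall>b\<in>Z. \<exists>c\<in>Z. \<forall>u\<in>U c. x * u \<in> U b}"

context
  fixes S Z
  assumes sub: "subbasis S Z"
begin

lemma sub_dir: "b \<in> Z \<Longrightarrow> b' \<in> Z \<Longrightarrow> \<exists>c\<in>Z. U c \<subseteq> U b \<inter> U b'"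
  using sub unfolding subbasis_def by (elim conjE) (drule (1) bspec)+

lemma sub_add: "b \<in> Z \<Longrightarrow> \<exists>c\<in>Z. \<forall>u\<in>U c. \<forall>v\<in>U c. u + v \<in> U b"
  using sub unfolding subbasis_def by simp

lemma sub_mult: "b \<in> Z \<Longrightarrow> \<exists>c\<in>Z. \<forall>u\<in>U c. \<forall>v\<in>U c. u * v \<in> U b"
  using sub unfolding subbasis_def by simp

lemma sub_Y: "b \<in> Z \<Longrightarrow> b \<in> Y"
  using sub unfolding subbasis_def by blast

lemma sub_open: "\<exists>y\<in>Y. U y \<subseteq> infinitesimals Z"
  using sub unfolding subbasis_def infinitesimals_def by (elim conjE) (simp add: le_INF_iff)

lemma one_notin: "1 \<notin> infinitesimals Z"
  using sub unfolding subbasis_def infinitesimals_def by (elim conjE) auto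

lemma Z_nonempty: "\<exists>b. b \<in> Z"
  using sub unfolding subbasis_def by (elim conjE) auto

lemma S_subset_stabilizer: "S \<subseteq> stabilizer Z"
  using sub unfolding subbasis_def stabilizer_def by (elim conjE) auto

lemma stabilizer_infinitesimals:
  assumes "x \<in> stabilizer Z" "j \<in> infinitesimals Z"
  shows "x * j \<in> infinitesimals Z"
  using assms by (fastforce simp: stabilizer_def infinitesimals_def)

lemma infinitesimals_subset_stabilizer: "infinitesimals Z \<subseteq> stabilizer Z"
  using sub_mult by (fastforce simp: stabilizer_def infinitesimals_def)

lemma infinitesimals_zero: "0 \<in> infinitesimals Z"
  using zero sub_Y by (auto simp: infinitesimals_def)

lemma infinitesimals_add:
  assumes "x \<in> infinitesimals Z" "y \<in> infinitesimals Z"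
  shows "x + y \<in> infinitesimals Z"
  unfolding infinitesimals_def
proof
  fix b assume "b \<in> Z"
  then obtain c where "c \<in> Z" "\<forall>u\<in>U c. \<forall>v\<in>U c. u + v \<in> U b" using sub_add by blast
  then show "x + y \<in> U b" using assms by (auto simp: infinitesimals_def)
qed

lemma infinitesimals_minus: "x \<in> infinitesimals Z \<Longrightarrow> - x \<in> infinitesimals Z"
  using stabilizer_infinitesimals[of "-1" x] S_subset_stabilizer sub by (auto simp: subbasis_def)

lemma infinitesimals_diff:
  "x \<in> infinitesimals Z \<Longrightarrow> y \<in> infinitesimals Z \<Longrightarrow> x - y \<in> infinitesimals Z"
  using infinitesimals_add[of x "- y"] infinitesimals_minus by simp

lemma infinitesimals_sum:
  "(\<And>i. i \<in> I \<Longrightarrow> f i \<in> infinitesimals Z) \<Longrightarrow> sum f I \<in> infinitesimals Z"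
  by (induction I rule: infinite_finite_induct) (auto simp: infinitesimals_zero infinitesimals_add)

lemma stabilizer_mult:
  assumes "x \<in> stabilizer Z" "y \<in> stabilizer Z"
  shows "x * y \<in> stabilizer Z"
proof -
  have "\<exists>c\<in>Z. \<forall>u\<in>U c. x * y * u \<in> U b" if b: "b \<in> Z" for b
  proof -
    obtain b1 where "b1 \<in> Z" "\<forall>u\<in>U b1. x * u \<in> U b" using assms b by (auto simp: stabilizer_def)
    moreover obtain b2 where "b2 \<in> Z" "\<forall>u\<in>U b2. y * u \<in> U b1"
      using assms \<open>b1 \<in> Z\<close> by (auto simp: stabilizer_def)
    ultimately show ?thesis by (intro bexI[of _ b2]) (auto simp: mult.assoc)
  qed
  then show ?thesis by (simp add: stabilizer_def)
qed

lemma stabilizer_add: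
  assumes "x \<in> stabilizer Z" "y \<in> stabilizer Z"
  shows "x + y \<in> stabilizer Z"
proof -
  have "\<exists>c\<in>Z. \<forall>u\<in>U c. (x + y) * u \<in> U b" if b: "b \<in> Z" for b
  proof -
    obtain b1 where b1: "b1 \<in> Z" "\<forall>u\<in>U b1. \<forall>v\<in>U b1. u + v \<in> U b" using sub_add b by blast
    obtain b2 where b2: "b2 \<in> Z" "\<forall>u\<in>U b2. x * u \<in> U b1"
      using assms b1 by (auto simp: stabilizer_def)
    obtain b3 where b3: "b3 \<in> Z" "\<forall>u\<in>U b3. y * u \<in> U b1"
      using assms b1 by (auto simp: stabilizer_def)
    obtain b4 where b4: "b4 \<in> Z" "U b4 \<subseteq> U b2 \<inter> U b3" using sub_dir b2 b3 by blast
    have "(x + y) * u \<in> U b" if "u \<in> U b4" for u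
    proof -
      have "x * u \<in> U b1" "y * u \<in> U b1" using that b2 b3 b4 by auto
      then show ?thesis using b1 by (simp add: distrib_right)
    qed
    then show ?thesis using b4 by blast
  qed
  then show ?thesis by (simp add: stabilizer_def)
qed

lemma stabilizer_subring: "is_subring (stabilizer Z)"
proof -
  have "0 \<in> stabilizer Z"
    using zero sub_Y by (auto simp: stabilizer_def)
  moreover have "1 \<in> stabilizer Z" by (auto simp: stabilizer_def)
  moreover have "x - y \<in> stabilizer Z" if "x \<in> stabilizer Z" "y \<in> stabilizer Z" for x y
  proof -
    have "-1 \<in> stabilizer Z" using S_subset_stabilizer sub by (auto simp: subbasis_def)
    then have "x + (-1) * y \<in> stabilizer Z" using that by (intro stabilizer_add stabilizer_mult)
    then show ?thesis by simp
  qed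
  ultimately show ?thesis using stabilizer_add stabilizer_mult by (simp add: is_subring_def)
qed

text \<open>The infinitesimals are a neighbourhood of \<open>0\<close> for the full topology, and multiplication by any
  element of the field is continuous.\<close>

lemma absorb: "\<exists>b\<in>Y. \<forall>u\<in>U b. a * u \<in> infinitesimals Z"
proof -
  obtain y where y: "y \<in> Y" "U y \<subseteq> infinitesimals Z" using sub_open by blast
  then show ?thesis using scale[OF y(1), of a] by blast
qed

lemma infinitesimals_nonzero: "\<exists>j\<in>infinitesimals Z. j \<noteq> 0"
proof -
  obtain y where y: "y \<in> Y" "U y \<subseteq> infinitesimals Z" using sub_open by blast
  then show ?thesis using nonzero[OF y(1)] by blast
qed

lemma stabilizer_proper: "stabilizer Z \<noteq> UNIV"
proof
  assume *: "stabilizer Z = UNIV"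
  obtain j where "j \<in> infinitesimals Z" "j \<noteq> 0" using infinitesimals_nonzero by blast
  then show False using stabilizer_infinitesimals[of "inverse j" j] * one_notin by simp
qed

lemma stabilizer_frac: "frac_eq_UNIV (stabilizer Z)"
  unfolding frac_eq_UNIV_def
proof
  fix x
  have "\<exists>b\<in>Y. \<forall>a\<in>{x, 1}. \<forall>u\<in>U b. a * u \<in> infinitesimals Z"
    by (rule common_nbhd) (simp_all only: absorb finite.intros)
  then obtain b where b: "b \<in> Y" "\<forall>u\<in>U b. x * u \<in> infinitesimals Z \<and> u \<in> infinitesimals Z"
    by auto
  obtain u where "u \<in> U b" "u \<noteq> 0" using nonzero[OF b(1)] by blast
  then show "\<exists>a\<in>stabilizer Z. \<exists>b\<in>stabilizer Z. b \<noteq> 0 \<and> x = a / b"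
    using b infinitesimals_subset_stabilizer
    by (intro bexI[of _ "x * u"] bexI[of _ u]) auto
qed

text \<open>An ideal with an element \<open>c \<noteq> 0\<close> contains \<open>c\<close> times the infinitesimals, because
  these belong to the ring.\<close>

lemma nbhd_in_ideal:
  assumes I: "is_ideal (stabilizer Z) I" "I \<noteq> {0}"
  shows "\<exists>b\<in>Y. U b \<subseteq> I"
proof -
  obtain c where c: "c \<in> I" "c \<noteq> 0" using I by (auto simp: is_ideal_def)
  obtain b where b: "b \<in> Y" "\<forall>u\<in>U b. inverse c * u \<in> infinitesimals Z" using absorb by blast
  have "u \<in> I" if "u \<in> U b" for u
  proof -
    have "inverse c * u \<in> stabilizer Z" using b that infinitesimals_subset_stabilizer by blast
    then have "(inverse c * u) * c \<in> I" using I(1) c by (simp add: is_ideal_def)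
    then show ?thesis using c by (simp add: field_simps)
  qed
  then show ?thesis using b by blast
qed

text \<open>The ideal is \<open>c\<close> times the infinitesimals of \<open>Z\<close>; it is contained in every neighbourhood
  indexed by \<open>Z'\<close>.\<close>

lemma ideal_in_nbhd:
  assumes "b \<in> Z'" "infinitesimals Z' \<subseteq> infinitesimals Z"
    and c: "c \<noteq> 0" "\<forall>j\<in>infinitesimals Z. c * j \<in> infinitesimals Z'"
  shows "\<exists>I. is_ideal (stabilizer Z) I \<and> I \<noteq> {0} \<and> I \<subseteq> U b"
proof (intro exI conjI)
  let ?I = "(\<lambda>j. c * j) ` infinitesimals Z"
  show "?I \<subseteq> U b" using assms by (auto simp: infinitesimals_def)
  obtain j where "j \<in> infinitesimals Z" "j \<noteq> 0" using infinitesimals_nonzero by blast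
  then have "c * j \<in> ?I" "c * j \<noteq> 0" using c by auto
  then show "?I \<noteq> {0}" by blast
  have "?I \<subseteq> stabilizer Z" using assms infinitesimals_subset_stabilizer by blast
  moreover have "x + y \<in> ?I" if "x \<in> ?I" "y \<in> ?I" for x y
    using that infinitesimals_add by (auto simp flip: distrib_left)
  moreover have "r * x \<in> ?I" if "r \<in> stabilizer Z" "x \<in> ?I" for r x
    using that stabilizer_infinitesimals[of r] by (auto simp: mult.left_commute[of r])
  ultimately show "is_ideal (stabilizer Z) ?I"
    using infinitesimals_zero by (force simp: is_ideal_def)
qed

lemma avoid_finite:
  assumes "finite X" "X \<inter> infinitesimals Z = {}"
  shows "\<exists>b\<in>Z. X \<inter> U b = {}"
  using assms
proof (induction X rule: finite_induct)
  case empty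
  then show ?case using Z_nonempty by auto
next
  case (insert x X)
  then obtain b where "b \<in> Z" "X \<inter> U b = {}" by auto
  moreover obtain b' where "b' \<in> Z" "x \<notin> U b'" using insert.prems by (auto simp: infinitesimals_def)
  ultimately show ?case using sub_dir[of b b'] by blast
qed

text \<open>The sets of pairs \<open>(z, y)\<close> with \<open>U\<^sub>z \<subseteq> U\<^sub>b\<close> and \<open>U\<^sub>y \<subseteq> U\<^sub>c\<close> where \<open>c = g(z)\<close>, for \<open>b\<close> in \<open>Z\<close> and \<open>g\<close> a
  function from \<open>Z\<close> to itself, generate a filter; any ultrafilter that refines it will do. If
  \<open>x\<close> is in the ring, let \<open>g(z)\<close> witness continuity of multiplication by \<open>x\<close> at \<open>z\<close>. Conversely, if
  \<open>x U\<^sub>y \<subseteq> U\<^sub>z\<close> holds along the ultrafilter, it holds for some pair with \<open>U\<^sub>z \<subseteq> U\<^sub>b\<close>, for any given \<open>b\<close>.\<close>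

lemma stabilizer_ultrafilter:
  "\<exists>F. ultrafilter F \<and> eventually (\<lambda>(z, y). z \<in> Z \<and> y \<in> Z) F \<and>
     (\<forall>x. x \<in> stabilizer Z \<longleftrightarrow> eventually (\<lambda>(z, y). \<forall>u\<in>U y. x * u \<in> U z) F)"
proof -
  define B where "B = (\<lambda>(b, g). {(z, y). z \<in> Z \<and> y \<in> Z \<and> U z \<subseteq> U b \<and> U y \<subseteq> U (g z)})"
  define I where "I = Z \<times> {g. g ` Z \<subseteq> Z}"
  define F0 where "F0 = (INF i\<in>I. principal (B i))"
  have I_nonempty: "I \<noteq> {}" using Z_nonempty by (auto simp: I_def intro!: exI[of _ id])
  have ev: "eventually P F0 \<longleftrightarrow> (\<exists>i\<in>I. \<forall>p\<in>B i. P p)" for P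
    unfolding F0_def eventually_principal[symmetric]
  proof (rule eventually_INF_base[OF I_nonempty])
    fix i i' assume "i \<in> I" "i' \<in> I"
    then obtain b g b' g' where i: "i = (b, g)" "i' = (b', g')"
      and b: "b \<in> Z" "b' \<in> Z" and g: "g ` Z \<subseteq> Z" "g' ` Z \<subseteq> Z" by (auto simp: I_def)
    obtain b'' where b'': "b'' \<in> Z" "U b'' \<subseteq> U b \<inter> U b'" using sub_dir b by blast
    have "\<forall>z\<in>Z. \<exists>c\<in>Z. U c \<subseteq> U (g z) \<inter> U (g' z)" using sub_dir g by blast
    then obtain g'' where g'': "\<And>z. z \<in> Z \<Longrightarrow> g'' z \<in> Z \<and> U (g'' z) \<subseteq> U (g z) \<inter> U (g' z)"
      by metis
    have "B (b'', g'') \<subseteq> B i \<inter> B i'"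
    proof
      fix p assume "p \<in> B (b'', g'')"
      then obtain z y where p: "p = (z, y)" "z \<in> Z" "y \<in> Z" "U z \<subseteq> U b''" "U y \<subseteq> U (g'' z)"
        by (auto simp: B_def)
      then show "p \<in> B i \<inter> B i'" using b''(2) g''[of z] by (auto simp: B_def i)
    qed
    moreover have "(b'', g'') \<in> I" using b'' g'' by (auto simp: I_def)
    ultimately show "\<exists>x\<in>I. principal (B x) \<le> inf (principal (B i)) (principal (B i'))"
      by (intro bexI) auto
  qed
  have "B i \<noteq> {}" if "i \<in> I" for i
  proof -
    obtain b g where "i = (b, g)" "b \<in> Z" "g ` Z \<subseteq> Z" using \<open>i \<in> I\<close> by (auto simp: I_def)
    then have "(b, g b) \<in> B i" by (auto simp: B_def)
    then show ?thesis by blast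
  qed
  then have "F0 \<noteq> bot" unfolding trivial_limit_def ev by fast
  then obtain F where F: "F \<le> F0" "ultrafilter F" using ultrafilter_refines by blast
  have evF: "eventually P F" if "i \<in> I" "\<And>p. p \<in> B i \<Longrightarrow> P p" for P i
    using filter_leD[OF F(1)] that ev by blast
  obtain b0 where b0: "b0 \<in> Z" using Z_nonempty by blast
  have "eventually (\<lambda>(z, y). z \<in> Z \<and> y \<in> Z) F"
    by (rule evF[of "(b0, id)"]) (use b0 in \<open>auto simp: I_def B_def\<close>)
  moreover have "x \<in> stabilizer Z \<longleftrightarrow> eventually (\<lambda>(z, y). \<forall>u\<in>U y. x * u \<in> U z) F" for x
  proof
    assume "x \<in> stabilizer Z"
    then have "\<forall>z\<in>Z. \<exists>c\<in>Z. \<forall>u\<in>U c. x * u \<in> U z" by (simp add: stabilizer_def)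
    then obtain g where "\<And>z. z \<in> Z \<Longrightarrow> g z \<in> Z \<and> (\<forall>u\<in>U (g z). x * u \<in> U z)" by metis
    then show "eventually (\<lambda>(z, y). \<forall>u\<in>U y. x * u \<in> U z) F"
      using b0 by (intro evF[of "(b0, g)"]) (auto simp: I_def B_def)
  next
    assume x: "eventually (\<lambda>(z, y). \<forall>u\<in>U y. x * u \<in> U z) F"
    have "\<exists>y\<in>Z. \<forall>u\<in>U y. x * u \<in> U b" if b: "b \<in> Z" for b
    proof -
      have "eventually (\<lambda>(z, y). y \<in> Z \<and> U z \<subseteq> U b) F"
        by (rule evF[of "(b, id)"]) (use b in \<open>auto simp: I_def B_def\<close>)
      with x have "eventually (\<lambda>(z, y). y \<in> Z \<and> U z \<subseteq> U b \<and> (\<forall>u\<in>U y. x * u \<in> U z)) F"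
        by eventually_elim auto
      moreover have "F \<noteq> bot" using F(2) by (simp add: ultrafilter_def)
      ultimately obtain p where
        "case p of (z, y) \<Rightarrow> y \<in> Z \<and> U z \<subseteq> U b \<and> (\<forall>u\<in>U y. x * u \<in> U z)"
        using eventually_happens' by blast
      then obtain z y where "y \<in> Z" "U z \<subseteq> U b" "\<forall>u\<in>U y. x * u \<in> U z"
        by (cases p) auto
      then show ?thesis by blast
    qed
    then show "x \<in> stabilizer Z" by (simp add: stabilizer_def)
  qed
  ultimately show ?thesis using F(2) by blast
qed

end

section \<open>Independence along a chain\<close>

text \<open>The sets \<open>{x. c\<^sub>k x \<in> U\<^sub>b}\<close>, with \<open>b = b\<^sub>k\<close> and \<open>k < N\<close>, have all \<open>2\<^sup>N\<close> Boolean combinations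
  non-empty. In terms of the formula \<open>c x \<in> U\<^sub>b\<close> it is the pairs \<open>(c, b)\<close> that are shattered by the
  elements \<open>x\<close>.\<close>

definition shatters :: "nat \<Rightarrow> bool" where
  "shatters N \<longleftrightarrow> (\<exists>c b x. (\<forall>k<N. b k \<in> Y) \<and>
     (\<forall>T\<subseteq>{..<N}. \<forall>k<N. c k * x T \<in> U (b k) \<longleftrightarrow> k \<notin> T))"

context
  fixes S :: "nat \<Rightarrow> 'a set" and Z :: "nat \<Rightarrow> 'i set"
  assumes sub: "\<And>i. subbasis (S i) (Z i)"
    and decreasing: "\<And>i. infinitesimals (Z (Suc i)) \<subseteq> infinitesimals (Z i)"
    and strict: "\<And>i c. c \<noteq> 0 \<Longrightarrow> \<exists>j\<in>infinitesimals (Z i). c * j \<notin> infinitesimals (Z (Suc i))"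
begin

text \<open>Given \<open>N\<close> scalars and points, the next scalar \<open>c'\<close> is chosen small enough to bring all earlier
  points into the new group. The next point has the form \<open>d j\<close>. Here \<open>d\<close> is small enough for
  the earlier scalars, so \<open>d j\<close> lies in all earlier groups for every infinitesimal \<open>j\<close> of stage
  \<open>N\<close>; and since \<open>c' d \<noteq> 0\<close>, strictness of the chain gives such a \<open>j\<close> for which \<open>d j\<close> is not in the new group.
  The groups use stage \<open>k + 1\<close>, which leaves stage \<open>N\<close> free to supply \<open>j\<close>.\<close>

lemma independent_points:
  "\<exists>c x. (\<forall>i<N. c i \<noteq> 0) \<and>
     (\<forall>i<N. \<forall>k<N. c k * x i \<in> infinitesimals (Z (Suc k)) \<longleftrightarrow> i \<noteq> k)"
proof (induction N)
  case (Suc N)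
  define D where "D k = infinitesimals (Z (Suc k))" for k
  obtain c x where c: "\<And>i. i < N \<Longrightarrow> c i \<noteq> 0"
    and x: "\<And>i k. i < N \<Longrightarrow> k < N \<Longrightarrow> c k * x i \<in> D k \<longleftrightarrow> i \<noteq> k"
    using Suc unfolding D_def by metis
  have "\<exists>b\<in>Y. \<forall>i\<in>{..<N}. \<forall>u\<in>U b. x i * u \<in> D N"
    unfolding D_def by (rule common_nbhd) (simp_all only: absorb[OF sub] finite_lessThan)
  then obtain c' where c': "c' \<noteq> 0" "\<And>i. i < N \<Longrightarrow> c' * x i \<in> D N"
    by (metis lessThan_iff mult.commute nonzero)
  have "\<exists>b\<in>Y. \<forall>k\<in>{..<N}. \<forall>u\<in>U b. c k * u \<in> D k"
    unfolding D_def by (rule common_nbhd) (simp_all only: absorb[OF sub] finite_lessThan)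
  then obtain d where d: "d \<noteq> 0" "\<And>k. k < N \<Longrightarrow> c k * d \<in> D k"
    by (metis lessThan_iff nonzero)
  obtain j where j: "j \<in> infinitesimals (Z N)" "(c' * d) * j \<notin> D N"
    using strict[of "c' * d" N] c' d by (auto simp: D_def)
  have "c k * (d * j) \<in> D k" if "k < N" for k
  proof -
    have "infinitesimals (Z N) \<subseteq> D k"
      using that lift_Suc_antimono_le[of "\<lambda>i. infinitesimals (Z i)" "Suc k" N] decreasing
      by (simp add: D_def)
    moreover have "c k * d \<in> stabilizer (Z (Suc k))"
      using d(2)[OF that] infinitesimals_subset_stabilizer[OF sub] by (auto simp: D_def)
    ultimately have "(c k * d) * j \<in> D k"
      using stabilizer_infinitesimals[OF sub] j(1) by (auto simp: D_def)
    then show ?thesis by (simp add: mult.assoc)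
  qed
  moreover have "c' * (d * j) \<notin> D N" using j(2) by (simp add: mult.assoc)
  ultimately show ?case
    using c x c' by (intro exI[of _ "c(N := c')"] exI[of _ "x(N := d * j)"])
      (auto simp: less_Suc_eq D_def)
qed simp

text \<open>Subset sums of independent points realize all patterns, because the sets involved are
  additive groups. The groups are intersections of directed families and only finitely many points
  matter, so a single neighbourhood can replace each group.\<close>

lemma chain_shatters: "shatters N"
proof -
  define D where "D k = infinitesimals (Z (Suc k))" for k
  obtain c x :: "nat \<Rightarrow> 'a"
    where x: "\<And>i k. i < N \<Longrightarrow> k < N \<Longrightarrow> c k * x i \<in> D k \<longleftrightarrow> i \<noteq> k"
    using independent_points[of N] unfolding D_def by metis
  define s where "s T = sum x T" for T
  have D: "c k * s T \<in> D k \<longleftrightarrow> k \<notin> T" if T: "T \<subseteq> {..<N}" and k: "k < N" for k T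
  proof -
    have fin: "finite T" using T finite_subset by blast
    have others: "(\<Sum>i\<in>T - {k}. c k * x i) \<in> D k"
      unfolding D_def by (rule infinitesimals_sum[OF sub]) (use x k T in \<open>auto simp: D_def\<close>)
    show ?thesis
    proof (cases "k \<in> T")
      case False
      then show ?thesis using others by (simp add: s_def sum_distrib_left)
    next
      case True
      have "c k * x k = c k * s T - (\<Sum>i\<in>T - {k}. c k * x i)"
        using True fin by (simp add: s_def sum_distrib_left sum.remove distrib_left)
      moreover have "c k * x k \<notin> D k" using x k by blast
      ultimately show ?thesis using True others infinitesimals_diff[OF sub] by (auto simp: D_def)
    qed
  qed
  have "\<exists>b\<in>Z (Suc k). \<forall>T\<subseteq>{..<N}. c k * s T \<in> U b \<longrightarrow> c k * s T \<in> D k" for k :: nat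
  proof -
    let ?X = "(\<lambda>T. c k * s T) ` Pow {..<N} - D k"
    obtain b where b: "b \<in> Z (Suc k)" "?X \<inter> U b = {}"
      using avoid_finite[OF sub, of ?X "Suc k"] by (auto simp: D_def)
    then have "c k * s T \<in> D k" if "T \<subseteq> {..<N}" "c k * s T \<in> U b" for T
      using that by blast
    then show ?thesis using b(1) by blast
  qed
  then obtain b :: "nat \<Rightarrow> 'i" where b: "\<And>k. b k \<in> Z (Suc k)"
    "\<And>k T. T \<subseteq> {..<N} \<Longrightarrow> c k * s T \<in> U (b k) \<Longrightarrow> c k * s T \<in> D k" by metis
  have "c k * s T \<in> U (b k) \<longleftrightarrow> k \<notin> T" if "T \<subseteq> {..<N}" "k < N" for k T
  proof -
    have "D k \<subseteq> U (b k)" using b(1)[of k] by (auto simp: D_def infinitesimals_def)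
    then have "c k * s T \<in> U (b k) \<longleftrightarrow> c k * s T \<in> D k" using b(2)[OF that(1)] by blast
    then show ?thesis using D[OF that] by simp
  qed
  moreover have "b k \<in> Y" for k using sub_Y[OF sub] b(1) by blast
  ultimately show ?thesis unfolding shatters_def by blast
qed

end

end

section \<open>Neighbourhoods in a ring topology\<close>

lemma continuous_map_prod_nhds:
  assumes "continuous_map (prod_topology \<tau> \<tau>) \<tau> f" "topspace \<tau> = UNIV" "openin \<tau> W" "f (a, b) \<in> W"
  obtains V V' where "openin \<tau> V" "openin \<tau> V'" "a \<in> V" "b \<in> V'"
    "\<And>u v. u \<in> V \<Longrightarrow> v \<in> V' \<Longrightarrow> f (u, v) \<in> W"
proof -
  let ?W = "{p \<in> topspace (prod_topology \<tau> \<tau>). f p \<in> W}"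
  have "openin (prod_topology \<tau> \<tau>) ?W"
    using assms by (intro openin_continuous_map_preimage)
  moreover have "(a, b) \<in> ?W" using assms by simp
  ultimately have "\<exists>V V'. openin \<tau> V \<and> openin \<tau> V' \<and> a \<in> V \<and> b \<in> V' \<and> V \<times> V' \<subseteq> ?W"
    by (rule openin_prod_topology_alt[THEN iffD1, rule_format])
  then obtain V V' where V: "openin \<tau> V" "openin \<tau> V'" "a \<in> V" "b \<in> V'" "V \<times> V' \<subseteq> ?W"
    by (elim exE conjE)
  show ?thesis
  proof (rule that[OF V(1-4)])
    fix u v assume "u \<in> V" "v \<in> V'"
    then have "(u, v) \<in> ?W" by (intro subsetD[OF V(5)] SigmaI)
    then show "f (u, v) \<in> W" by simp
  qed
qed

lemma ring_topology_nbhds: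
  fixes \<tau> :: "'a :: field topology"
  assumes \<tau>: "ring_topology \<tau>"
    and op: "\<And>b. b \<in> Y \<Longrightarrow> openin \<tau> (U b) \<and> 0 \<in> U b"
    and base: "\<And>W. openin \<tau> W \<Longrightarrow> 0 \<in> W \<Longrightarrow> \<exists>b\<in>Y. U b \<subseteq> W"
  shows "ring_nbhds Y U"
proof
  have top: "topspace \<tau> = UNIV"
    and plus: "continuous_map (prod_topology \<tau> \<tau>) \<tau> (\<lambda>(x, y). x + y)"
    and minus: "continuous_map (prod_topology \<tau> \<tau>) \<tau> (\<lambda>(x, y). x - y)"
    and times: "continuous_map (prod_topology \<tau> \<tau>) \<tau> (\<lambda>(x, y). x * y)"
    and haus: "Hausdorff_space \<tau>" and nondisc: "\<tau> \<noteq> discrete_topology UNIV"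
    using \<tau> by (simp_all add: ring_topology_def)
  have two: "\<exists>c\<in>Y. \<forall>u\<in>U c. \<forall>v\<in>U c. f (u, v) \<in> U b"
    if cont: "continuous_map (prod_topology \<tau> \<tau>) \<tau> f" and f0: "f (0, 0) = 0" and b: "b \<in> Y" for f b
  proof -
    obtain V V' where V: "openin \<tau> V" "openin \<tau> V'" "0 \<in> V" "0 \<in> V'"
      "\<And>u v. u \<in> V \<Longrightarrow> v \<in> V' \<Longrightarrow> f (u, v) \<in> U b"
      using continuous_map_prod_nhds[OF cont top, of "U b" 0 0] op[OF b] f0 by metis
    obtain c where "c \<in> Y" "U c \<subseteq> V \<inter> V'"
      using base[of "V \<inter> V'"] V by auto
    then show ?thesis using V(5) by (intro bexI[of _ c]) auto
  qed
  show "0 \<in> U b" if "b \<in> Y" for b using op[OF that] by blast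
  show "\<exists>c\<in>Y. U c \<subseteq> U b \<inter> U b'" if "b \<in> Y" "b' \<in> Y" for b b'
    using op that by (intro base) auto
  show "\<exists>c\<in>Y. \<forall>u\<in>U c. \<forall>v\<in>U c. u + v \<in> U b" if "b \<in> Y" for b
    using two[OF plus _ that] by simp
  show "\<exists>c\<in>Y. \<forall>u\<in>U c. \<forall>v\<in>U c. u * v \<in> U b" if "b \<in> Y" for b
    using two[OF times _ that] by simp
  show "\<exists>c\<in>Y. \<forall>u\<in>U c. a * u \<in> U b" if b: "b \<in> Y" for a b
  proof -
    obtain V V' where V: "openin \<tau> V" "openin \<tau> V'" "a \<in> V" "0 \<in> V'"
      "\<And>u v. u \<in> V \<Longrightarrow> v \<in> V' \<Longrightarrow> (\<lambda>(x, y). x * y) (u, v) \<in> U b"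
      by (rule continuous_map_prod_nhds[OF times top, of "U b" a 0]) (use op[OF b] in auto)
    then obtain c where "c \<in> Y" "U c \<subseteq> V'" using base by blast
    then show ?thesis using V(3) V(5)[of a] by (intro bexI[of _ c]) auto
  qed
  show "\<exists>u\<in>U b. u \<noteq> 0" if b: "b \<in> Y" for b
  proof (rule ccontr)
    assume "\<not> ?thesis"
    then have U: "U b = {0}" using op[OF b] by blast
    \<comment> \<open>translating \<open>{0}\<close> by continuity of subtraction at \<open>(a, a)\<close>\<close>
    have "openin \<tau> {a}" for a
    proof -
      obtain V V' where V: "openin \<tau> V" "openin \<tau> V'" "a \<in> V" "a \<in> V'"
        "\<And>u v. u \<in> V \<Longrightarrow> v \<in> V' \<Longrightarrow> (\<lambda>(x, y). x - y) (u, v) \<in> U b"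
        by (rule continuous_map_prod_nhds[OF minus top, of "U b" a a]) (use op[OF b] in auto)
      have "u = a" if "u \<in> V" for u using V(5)[OF that V(4)] by (simp add: U)
      then have "V = {a}" using V(3) by blast
      then show ?thesis using V(1) by simp
    qed
    then have "discrete_topology UNIV = \<tau>" using top by (simp add: discrete_topology_unique)
    then show False using nondisc by simp
  qed
  show "\<exists>b\<in>Y. a \<notin> U b" if a: "a \<noteq> 0" for a
  proof -
    obtain V V' where "openin \<tau> V" "openin \<tau> V'" "0 \<in> V" "a \<in> V'" "disjnt V V'"
      using haus[unfolded Hausdorff_space_def, rule_format, of 0 a] a top by auto
    then show ?thesis using base[of V] by (auto simp: disjnt_iff)
  qed
qed

section \<open>Definable neighbourhood bases\<close>

definition tup :: "nat \<Rightarrow> nat \<Rightarrow> (nat \<Rightarrow> 'a) \<Rightarrow> 'a list" where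
  "tup n k e = map (\<lambda>i. e (k + i)) [0..<n]"

lemma tup_shift: "tup n k (\<lambda>i. e (Suc i)) = tup n (Suc k) e"
  "tup n k (\<lambda>i. e (Suc (Suc i))) = tup n (Suc (Suc k)) e"
  "tup n k (\<lambda>i. e (Suc (Suc (Suc i)))) = tup n (Suc (Suc (Suc k))) e"
  by (simp_all add: tup_def)

lemma length_tup [simp]: "length (tup n k e) = n"
  by (simp add: tup_def)

lemma tup_asg: "length xs = k \<Longrightarrow> length ys = n \<Longrightarrow> tup n k (asg (xs @ ys @ zs) d) = ys"
  by (rule nth_equalityI) (auto simp: tup_def asg_def nth_append)

text \<open>Padding reserves the first variables, so that parameters can be placed after a tuple that is
  not yet known.\<close>

lemma asg_asg: "asg xs (asg (replicate (length xs) a @ ys) d) = asg (xs @ ys) d"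
  by (auto simp: asg_def fun_eq_iff nth_append)

lemma dpred_mono: "dpred L M A P \<Longrightarrow> A \<subseteq> B \<Longrightarrow> dpred L M B P"
  unfolding dpred_def by blast

lemma dpred_definable:
  fixes M :: "('a, 'f, 'r) struc"
  assumes X: "definable L M n X" and M: "univ M = UNIV"
  obtains e0 :: "nat \<Rightarrow> 'a" where "X \<subseteq> {xs. length xs = n}" "dpred L M (range e0) (\<lambda>e. tup n 0 e \<in> X)"
proof -
  obtain \<phi> e0 where *: "wf_fm L \<phi>" "X = {xs \<in> tuples n (univ M). sat M (asg xs e0) \<phi>}"
    using X unfolding definable_def by blast
  define \<sigma> where "\<sigma> i = (if i < n then Inl i else Inr (e0 i))" for i
  have "pval \<sigma> e = asg (tup n 0 e) e0" for e :: "nat \<Rightarrow> 'a"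
    by (auto simp: pval_def \<sigma>_def asg_def tup_def fun_eq_iff)
  then have "tup n 0 e \<in> X \<longleftrightarrow> sat M (pval \<sigma> e) \<phi>" for e
    by (simp add: *(2) tuples_def M)
  moreover have "dpred L M (range e0) (\<lambda>e. sat M (pval \<sigma> e) \<phi>)"
    by (rule dpredI[OF *(1)]) (auto simp: \<sigma>_def)
  ultimately have "dpred L M (range e0) (\<lambda>e. tup n 0 e \<in> X)" by simp
  moreover have "X \<subseteq> {xs. length xs = n}" using *(2) by (auto simp: tuples_def)
  ultimately show ?thesis using that by blast
qed

locale definable_nbhds = ring_nbhds Y U
  for Y :: "'a :: field list set" and U :: "'a list \<Rightarrow> 'a set" +
  fixes L :: "('f, 'r) language" and K :: "('a, 'f, 'r) struc"
    and plus_sym times_sym :: 'f and C :: "'a set" and n :: nat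
  assumes field: "expands_field L plus_sym times_sym K"
    and Y_length: "b \<in> Y \<Longrightarrow> length b = n"
    and Y_dpred: "dpred L K C (\<lambda>e. tup n 0 e \<in> Y)"
    and U_dpred: "dpred L K C (\<lambda>e. e 0 \<in> U (tup n 1 e))"
    and C_minus_one: "-1 \<in> C"
    and C_base: "\<exists>b\<in>Y. set b \<subseteq> C \<and> 1 \<notin> U b"
begin

lemma K: "is_struc L K" "univ K = UNIV"
  using field by (simp_all add: expands_field_def)

lemma all_dpred:
  assumes "dpred L K A (\<lambda>e. P (e 0) (\<lambda>i. e (Suc i)))"
  shows "dpred L K A (\<lambda>e. \<forall>a. P a e)"
  using dpred_all[OF assms] by (simp add: K)

lemma U_dpred_at:
  assumes "C \<subseteq> A"
  shows "dpred L K A (\<lambda>e. e j \<in> U (tup n k e))"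
  using dpred_ren[OF dpred_mono[OF U_dpred assms], of "\<lambda>i. if i = 0 then j else k + (i - 1)"]
  by (simp add: tup_def)

lemma Y_dpred_at:
  assumes "C \<subseteq> A"
  shows "dpred L K A (\<lambda>e. tup n k e \<in> Y)"
  using dpred_ren[OF dpred_mono[OF Y_dpred assms], of "\<lambda>i. k + i"] by (simp add: tup_def)

lemma add_dpred: "dpred L K A (\<lambda>e. e i = e j + e k)"
  and mult_dpred: "dpred L K A (\<lambda>e. e i = e j * e k)"
proof -
  have "wf_fm L (Eq (Var i) (Fun plus_sym [Var j, Var k]))"
    "wf_fm L (Eq (Var i) (Fun times_sym [Var j, Var k]))"
    using field by (simp_all add: expands_field_def)
  from this[THEN dpred_sat, of K A] field
  show "dpred L K A (\<lambda>e. e i = e j + e k)" "dpred L K A (\<lambda>e. e i = e j * e k)"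
    by (simp_all add: expands_field_def)
qed

definition points :: "'a set \<Rightarrow> 'a list set" where
  "points S = {b \<in> Y. set b \<subseteq> S}"

lemma points_mono: "S \<subseteq> S' \<Longrightarrow> infinitesimals (points S') \<subseteq> infinitesimals (points S)"
  by (auto simp: points_def infinitesimals_def)

text \<open>The value \<open>-1\<close> of the unused variables is arbitrary; it only has to belong to \<open>S\<close>.\<close>

lemma tuple_in_elementary:
  assumes S: "tarski_vaught L K S" and P: "dpred L K S P" and xs: "set xs \<subseteq> S"
    and ys: "length ys = n" "P (asg (ys @ xs) (\<lambda>_. -1))" and "C \<subseteq> S"
  shows "\<exists>ys. length ys = n \<and> set ys \<subseteq> S \<and> P (asg (ys @ xs) (\<lambda>_. -1))"
proof -
  let ?e = "asg (replicate n (-1) @ xs) (\<lambda>_. -1)"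
  have one: "-1 \<in> S" using assms(6) C_minus_one by blast
  have "\<exists>ys\<in>tuples n (univ K). P (asg ys ?e)"
    using ys asg_asg[of ys "-1" xs "\<lambda>_. -1"] by (auto simp: tuples_def K)
  then have "\<exists>ys\<in>tuples n S. P (asg ys ?e)"
    using one xs by (intro tarski_vaught_tuple[OF S P] range_asg) auto
  then obtain ys where "ys \<in> tuples n S" "P (asg ys ?e)" by blast
  then show ?thesis using asg_asg[of ys "-1" xs "\<lambda>_. -1"] by (auto simp: tuples_def)
qed

context
  fixes S
  assumes S: "tarski_vaught L K S" "C \<subseteq> S"
begin

text \<open>Each of the next four properties says that some index \<open>c\<close> with a definable property exists,
  given indices and scalars from \<open>S\<close>. It holds in the field, so a witness can be found in \<open>S\<close>.\<close>

lemma points_dir: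
  assumes "b \<in> points S" "b' \<in> points S"
  shows "\<exists>c\<in>points S. U c \<subseteq> U b \<inter> U b'"
proof -
  define P where "P e \<longleftrightarrow> tup n 0 e \<in> Y \<and>
    (\<forall>u. u \<in> U (tup n 0 e) \<longrightarrow> u \<in> U (tup n n e) \<and> u \<in> U (tup n (n + n) e))" for e
  have b: "b \<in> Y" "b' \<in> Y" "length b = n" "length b' = n" "set (b @ b') \<subseteq> S"
    using assms Y_length by (auto simp: points_def)
  have "dpred L K S P"
    unfolding P_def[abs_def]
    by (intro dpred_conj all_dpred dpred_imp; (simp only: tup_shift)?) (intro U_dpred_at Y_dpred_at S)+
  moreover have P: "P (asg (c @ b @ b') d) \<longleftrightarrow> c \<in> Y \<and> U c \<subseteq> U b \<inter> U b'" if "length c = n" for c d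
    using that b tup_asg[of "[]" 0 c n "b @ b'" d] tup_asg[of c n b n b' d]
      tup_asg[of "c @ b" "n + n" b' n "[]" d] by (auto simp: P_def)
  moreover obtain c where "c \<in> Y" "U c \<subseteq> U b \<inter> U b'" using dir b by blast
  ultimately obtain c where "length c = n" "set c \<subseteq> S" "P (asg (c @ b @ b') (\<lambda>_. -1))"
    using tuple_in_elementary[OF S(1) _ b(5) _ _ S(2), of P c] Y_length by blast
  then show ?thesis using P by (auto simp: points_def)
qed

lemma points_add:
  assumes "b \<in> points S"
  shows "\<exists>c\<in>points S. \<forall>u\<in>U c. \<forall>v\<in>U c. u + v \<in> U b"
proof -
  define P where "P e \<longleftrightarrow> tup n 0 e \<in> Y \<and> (\<forall>u. u \<in> U (tup n 0 e) \<longrightarrow>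
    (\<forall>v. v \<in> U (tup n 0 e) \<longrightarrow> (\<forall>w. w = u + v \<longrightarrow> w \<in> U (tup n n e))))" for e
  have b: "b \<in> Y" "length b = n" "set b \<subseteq> S"
    using assms Y_length by (auto simp: points_def)
  have "dpred L K S P"
    unfolding P_def[abs_def]
    by (intro dpred_conj all_dpred dpred_imp; (simp only: tup_shift)?)
      (intro U_dpred_at Y_dpred_at add_dpred S)+
  moreover have P: "P (asg (c @ b) d) \<longleftrightarrow> c \<in> Y \<and> (\<forall>u\<in>U c. \<forall>v\<in>U c. u + v \<in> U b)"
    if "length c = n" for c d
    using that b tup_asg[of "[]" 0 c n b d] tup_asg[of c n b n "[]" d] by (auto simp: P_def)
  moreover obtain c where "c \<in> Y" "\<forall>u\<in>U c. \<forall>v\<in>U c. u + v \<in> U b" using add b by blast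
  ultimately obtain c where "length c = n" "set c \<subseteq> S" "P (asg (c @ b) (\<lambda>_. -1))"
    using tuple_in_elementary[OF S(1) _ b(3) _ _ S(2), of P c] Y_length by blast
  then show ?thesis using P by (auto simp: points_def)
qed

lemma points_mult:
  assumes "b \<in> points S"
  shows "\<exists>c\<in>points S. \<forall>u\<in>U c. \<forall>v\<in>U c. u * v \<in> U b"
proof -
  define P where "P e \<longleftrightarrow> tup n 0 e \<in> Y \<and> (\<forall>u. u \<in> U (tup n 0 e) \<longrightarrow>
    (\<forall>v. v \<in> U (tup n 0 e) \<longrightarrow> (\<forall>w. w = u * v \<longrightarrow> w \<in> U (tup n n e))))" for e
  have b: "b \<in> Y" "length b = n" "set b \<subseteq> S"
    using assms Y_length by (auto simp: points_def)
  have "dpred L K S P"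
    unfolding P_def[abs_def]
    by (intro dpred_conj all_dpred dpred_imp; (simp only: tup_shift)?)
      (intro U_dpred_at Y_dpred_at mult_dpred S)+
  moreover have P: "P (asg (c @ b) d) \<longleftrightarrow> c \<in> Y \<and> (\<forall>u\<in>U c. \<forall>v\<in>U c. u * v \<in> U b)"
    if "length c = n" for c d
    using that b tup_asg[of "[]" 0 c n b d] tup_asg[of c n b n "[]" d] by (auto simp: P_def)
  moreover obtain c where "c \<in> Y" "\<forall>u\<in>U c. \<forall>v\<in>U c. u * v \<in> U b" using mult b by blast
  ultimately obtain c where "length c = n" "set c \<subseteq> S" "P (asg (c @ b) (\<lambda>_. -1))"
    using tuple_in_elementary[OF S(1) _ b(3) _ _ S(2), of P c] Y_length by blast
  then show ?thesis using P by (auto simp: points_def)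
qed

lemma points_scale:
  assumes "a \<in> S" "b \<in> points S"
  shows "\<exists>c\<in>points S. \<forall>u\<in>U c. a * u \<in> U b"
proof -
  define P where "P e \<longleftrightarrow> tup n 0 e \<in> Y \<and> (\<forall>u. u \<in> U (tup n 0 e) \<longrightarrow>
    (\<forall>w. w = e (n + n) * u \<longrightarrow> w \<in> U (tup n n e)))" for e
  have b: "b \<in> Y" "length b = n" "set (b @ [a]) \<subseteq> S"
    using assms Y_length by (auto simp: points_def)
  have "dpred L K S P"
    unfolding P_def[abs_def]
    by (intro dpred_conj all_dpred dpred_imp; (simp only: tup_shift)?)
      (intro U_dpred_at Y_dpred_at mult_dpred S)+
  moreover have P: "P (asg (c @ b @ [a]) d) \<longleftrightarrow> c \<in> Y \<and> (\<forall>u\<in>U c. a * u \<in> U b)"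
    if "length c = n" for c d
  proof -
    have "asg (c @ b @ [a]) d (n + n) = a" using that b by (simp add: asg_def nth_append)
    then show ?thesis
      using that b tup_asg[of "[]" 0 c n "b @ [a]" d] tup_asg[of c n b n "[a]" d]
      by (auto simp: P_def)
  qed
  moreover obtain c where "c \<in> Y" "\<forall>u\<in>U c. a * u \<in> U b" using scale b by blast
  ultimately obtain c where "length c = n" "set c \<subseteq> S" "P (asg (c @ b @ [a]) (\<lambda>_. -1))"
    using tuple_in_elementary[OF S(1) _ b(3) _ _ S(2), of P c] Y_length by blast
  then show ?thesis using P by (auto simp: points_def)
qed

lemma points_nonempty: "\<exists>b\<in>points S. 1 \<notin> U b"
  using C_base S(2) by (auto simp: points_def)

text \<open>The conditions \<open>U\<^sub>y \<subseteq> U\<^sub>b\<close> on \<open>y\<close>, for \<open>b\<close> a point of \<open>S\<close>, form a partial type over \<open>S\<close>,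
  which is finitely satisfiable because the basis is directed.\<close>

lemma points_lower_bound:
  assumes "saturated L K \<kappa>" "|S| <o \<kappa>"
  shows "\<exists>y\<in>Y. \<forall>b\<in>points S. U y \<subseteq> U b"
proof -
  define P where "P e \<longleftrightarrow> tup n 0 e \<in> Y \<and> (\<forall>u. u \<in> U (tup n 0 e) \<longrightarrow> u \<in> U (tup n n e))" for e
  have "dpred L K S P"
    unfolding P_def[abs_def]
    by (intro dpred_conj all_dpred dpred_imp; (simp only: tup_shift)?) (intro U_dpred_at Y_dpred_at S)+
  then obtain \<phi> T where \<phi>: "wf_fm L \<phi>" "\<And>e. range (T e) \<subseteq> S \<union> range e"
    "\<And>e xs. length xs = n \<Longrightarrow> P (asg xs e) \<longleftrightarrow> sat K (asg xs (T e)) \<phi>"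
    by (rule dpred_normal_form[where m = n]) (rule that)
  define E where "E b = asg (replicate n (-1) @ b) (\<lambda>_. -1)" for b :: "'a list"
  have P: "sat K (asg ys (T (E b))) \<phi> \<longleftrightarrow> ys \<in> Y \<and> U ys \<subseteq> U b" if "length ys = n" "length b = n" for ys b
  proof -
    have "sat K (asg ys (T (E b))) \<phi> \<longleftrightarrow> P (asg (ys @ b) (\<lambda>_. -1))"
      using asg_asg[of ys "-1" b "\<lambda>_. -1"] that by (simp add: \<phi>(3)[symmetric] E_def)
    then show ?thesis
      using that tup_asg[of "[]" 0 ys n b "\<lambda>_. -1"] tup_asg[of ys n b n "[]" "\<lambda>_. -1"]
      by (auto simp: P_def)
  qed
  have range: "range (T (E b)) \<subseteq> S" if "b \<in> points S" for b
  proof -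
    have "range (E b) \<subseteq> S" unfolding E_def
      using that S(2) C_minus_one by (intro range_asg) (auto simp: points_def)
    then show ?thesis using \<phi>(2)[of "E b"] by blast
  qed
  define p where "p = (\<lambda>b. (\<phi>, T (E b))) ` points S"
  have len: "length b = n" if "b \<in> points S" for b using that Y_length by (auto simp: points_def)
  have "\<exists>xs\<in>tuples n (univ K). \<forall>(\<phi>, e)\<in>q. sat K (asg xs e) \<phi>" if q: "q \<subseteq> p" "finite q" for q
  proof -
    obtain B where B: "B \<subseteq> points S" "finite B" "q = (\<lambda>b. (\<phi>, T (E b))) ` B"
      using finite_subset_image[OF q(2), of "\<lambda>b. (\<phi>, T (E b))" "points S"] q(1)
      by (auto simp: p_def)
    have "\<exists>c\<in>Y. \<forall>b\<in>B. \<forall>u\<in>U c. u \<in> U b"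
      by (rule common_nbhd[OF B(2)]) (use B(1) in \<open>auto simp: points_def\<close>)
    then obtain c where "c \<in> Y" "\<And>b. b \<in> B \<Longrightarrow> U c \<subseteq> U b" by blast
    then show ?thesis using P[of c] B len Y_length
      by (intro bexI[of _ c]) (auto simp: tuples_def K subset_eq)
  qed
  moreover have "wf_fm L \<phi> \<and> range (T (E b)) \<subseteq> univ K \<and> T (E b) ` (fv_fm \<phi> - {..<n}) \<subseteq> S"
    if "b \<in> points S" for b
    using range[OF that] \<phi>(1) by (auto simp: K)
  ultimately have "partial_type L K n S p"
    unfolding partial_type_def p_def by auto
  then obtain y where y: "y \<in> tuples n (univ K)" "\<forall>(\<phi>, e)\<in>p. sat K (asg y e) \<phi>"
    using assms unfolding saturated_def K by (metis subset_UNIV)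
  then have "\<forall>b\<in>points S. y \<in> Y \<and> U y \<subseteq> U b"
    using P[of y] len by (auto simp: p_def tuples_def)
  then show ?thesis using points_nonempty by blast
qed

lemma subbasis_points:
  assumes "saturated L K \<kappa>" "|S| <o \<kappa>"
  shows "subbasis S (points S)"
  unfolding subbasis_def
  using points_dir points_add points_mult points_scale points_nonempty
    points_lower_bound[OF assms] S(2) C_minus_one
  by (intro conjI ballI) (auto simp: points_def)

lemma externally_definable_stabilizer:
  assumes "saturated L K \<kappa>" "|S| <o \<kappa>"
  shows "externally_definable L K 1 ((\<lambda>x. [x]) ` stabilizer (points S))"
proof -
  obtain F where F: "ultrafilter F" "eventually (\<lambda>(z, y). z \<in> points S \<and> y \<in> points S) F"
    "\<And>x. x \<in> stabilizer (points S) \<longleftrightarrow> eventually (\<lambda>(z, y). \<forall>u\<in>U y. x * u \<in> U z) F"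
    using stabilizer_ultrafilter[OF subbasis_points[OF assms]] by blast
  define P where "P e \<longleftrightarrow> (\<forall>u. u \<in> U (tup n (Suc n) e) \<longrightarrow>
    (\<forall>w. w = e 0 * u \<longrightarrow> w \<in> U (tup n (Suc 0) e)))" for e
  have "dpred L K S P"
    unfolding P_def[abs_def]
    by (intro all_dpred dpred_imp; (simp only: tup_shift)?) (intro U_dpred_at mult_dpred S)+
  then obtain \<phi> T where \<phi>: "wf_fm L \<phi>" "\<And>e. range (T e) \<subseteq> S \<union> range e"
    "\<And>e xs. length xs = 1 \<Longrightarrow> P (asg xs e) \<longleftrightarrow> sat K (asg xs (T e)) \<phi>"
    by (rule dpred_normal_form[where m = 1]) (rule that)
  define E where "E = (\<lambda>(z, y). T (asg (0 # z @ y) (\<lambda>_. 0)))"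
  have "sat K (asg [x] (E (z, y))) \<phi> \<longleftrightarrow> (\<forall>u\<in>U y. x * u \<in> U z)"
    if "length z = n" "length y = n" for x y z
  proof -
    have "sat K (asg [x] (E (z, y))) \<phi> \<longleftrightarrow> P (asg ([x] @ z @ y) (\<lambda>_. 0))"
      using asg_asg[of "[x]" 0 "z @ y" "\<lambda>_. 0"] by (simp add: E_def \<phi>(3)[symmetric])
    then show ?thesis
      using that tup_asg[of "[x]" "Suc 0" z n y "\<lambda>_. 0"] tup_asg[of "x # z" "Suc n" y n "[]" "\<lambda>_. 0"]
      by (auto simp: P_def) (auto simp: asg_def)
  qed
  then have ev: "eventually (\<lambda>p. sat K (asg [x] (E p)) \<phi> \<longleftrightarrow> (case p of (z, y) \<Rightarrow> \<forall>u\<in>U y. x * u \<in> U z)) F"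
    for x
    using F(2) Y_length by (elim eventually_mono) (auto simp: points_def)
  have "x \<in> stabilizer (points S) \<longleftrightarrow> eventually (\<lambda>p. sat K (asg [x] (E p)) \<phi>) F" for x
    using eventually_subst[OF ev[of x]] by (simp add: F(3))
  then have "(\<lambda>x. [x]) ` stabilizer (points S) =
      {xs. length xs = 1 \<and> eventually (\<lambda>p. sat K (asg xs (E p)) \<phi>) F}"
    by (auto simp: length_Suc_conv)
  then show ?thesis using externally_definable_ultrafilter[OF K F(1) \<phi>(1)] by simp
qed

end

text \<open>The shattered tuples are the \<open>(c\<^sub>k, b\<^sub>k)\<close>, and the elements \<open>x\<^sub>T\<close> serve as parameters. The
  tuples are distinct because already the singletons \<open>T\<close> tell them apart.\<close>

lemma NIP_not_shatters:
  assumes "NIP L K"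
  shows "\<exists>N. \<not> shatters N"
proof (rule ccontr)
  assume "\<not> ?thesis"
  then have pattern: "shatters N" for N by blast
  define P where "P e \<longleftrightarrow> (\<forall>w. w = e 0 * e (Suc n) \<longrightarrow> w \<in> U (tup n (Suc 0) e))" for e
  have "dpred L K C P"
    unfolding P_def[abs_def]
    by (intro all_dpred dpred_imp; (simp only: tup_shift)?) (intro U_dpred_at mult_dpred order_refl)+
  then obtain \<phi> T where \<phi>: "wf_fm L \<phi>" "\<And>e. range (T e) \<subseteq> C \<union> range e"
    "\<And>e xs. length xs = Suc n \<Longrightarrow> P (asg xs e) \<longleftrightarrow> sat K (asg xs (T e)) \<phi>"
    by (rule dpred_normal_form[where m = "Suc n"]) (rule that)
  have sat: "sat K (asg (c # b) (T (\<lambda>_. x))) \<phi> \<longleftrightarrow> c * x \<in> U b" if "length b = n" for c b x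
  proof -
    have "sat K (asg (c # b) (T (\<lambda>_. x))) \<phi> \<longleftrightarrow> P (asg (c # b) (\<lambda>_. x))"
      using that by (simp add: \<phi>(3))
    then show ?thesis
      using that tup_asg[of "[c]" "Suc 0" b n "[]" "\<lambda>_. x"] by (auto simp: P_def asg_def)
  qed
  have "has_IP K (Suc n) \<phi>"
    unfolding has_IP_def
  proof
    fix N :: nat
    obtain c b x where b: "\<forall>k<N. b k \<in> Y"
      and x: "\<forall>T\<subseteq>{..<N}. \<forall>k<N. c k * x T \<in> U (b k) \<longleftrightarrow> k \<notin> T"
      using pattern[of N] unfolding shatters_def by (elim exE conjE)
    define A where "A = (\<lambda>k. c k # b k) ` {..<N}"
    have sat': "sat K (asg (c k # b k) (T (\<lambda>_. x R))) \<phi> \<longleftrightarrow> k \<notin> R"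
      if "R \<subseteq> {..<N}" "k < N" for R k
      using sat[of "b k"] x b that Y_length by simp
    have "inj_on (\<lambda>k. c k # b k) {..<N}"
    proof (rule inj_onI)
      fix k k' assume k: "k \<in> {..<N}" "k' \<in> {..<N}" "c k # b k = c k' # b k'"
      have "c k * x {k} \<notin> U (b k)" using k(1) x by simp
      then have "c k' * x {k} \<notin> U (b k')" using k(3) by simp
      then have "k' \<in> {k}" using k(1,2) x by simp
      then show "k = k'" by simp
    qed
    then have "card A = N" by (simp add: A_def card_image)
    moreover have "\<exists>e. range e \<subseteq> univ K \<and> {xs \<in> A. sat K (asg xs e) \<phi>} = Q" if "Q \<subseteq> A" for Q
    proof -
      define R where "R = {k \<in> {..<N}. c k # b k \<notin> Q}"
      have "sat K (asg (c k # b k) (T (\<lambda>_. x R))) \<phi> \<longleftrightarrow> c k # b k \<in> Q" if "k < N" for k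
        using sat'[of R k] that by (auto simp: R_def)
      then have "{xs \<in> A. sat K (asg xs (T (\<lambda>_. x R))) \<phi>} = Q"
        using that by (auto simp: A_def)
      then show ?thesis by (intro exI[of _ "T (\<lambda>_. x R)"]) (simp add: K)
    qed
    moreover have "A \<subseteq> tuples (Suc n) (univ K)"
      using b Y_length by (auto simp: A_def tuples_def K)
    ultimately show "\<exists>A\<subseteq>tuples (Suc n) (univ K). finite A \<and> card A = N \<and>
        (\<forall>S\<subseteq>A. \<exists>e. range e \<subseteq> univ K \<and> {xs \<in> A. sat K (asg xs e) \<phi>} = S)"
      by (intro exI[of _ A]) (auto simp: A_def)
  qed
  then show False using assms \<phi>(1) by (auto simp: NIP_def)
qed

definition small_model :: "'a set \<Rightarrow> bool" where
  "small_model S \<longleftrightarrow>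
     tarski_vaught L K S \<and> C \<subseteq> S \<and> |S| \<le>o |UNIV :: ('f + 'r + nat) set|"

lemma small_model_extend:
  assumes "small_model S \<or> S = C" and C: "|C| \<le>o |UNIV :: ('f + 'r + nat) set|" and "finite X"
  shows "\<exists>S'. small_model S' \<and> S \<union> X \<subseteq> S'"
proof -
  have inf: "infinite (UNIV :: ('f + 'r + nat) set)" by simp
  have "|S \<union> X| \<le>o |UNIV :: ('f + 'r + nat) set|"
    using assms card_finite_le[OF inf] inf by (intro card_Un_le) (auto simp: small_model_def)
  moreover have "C \<subseteq> S" using assms(1) by (auto simp: small_model_def)
  moreover have "C \<noteq> {}" using C_minus_one by blast
  ultimately obtain S' where "S \<union> X \<subseteq> S'" "|S'| \<le>o |UNIV :: ('f + 'r + nat) set|"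
    "tarski_vaught L K S'"
    using downward_loewenheim_skolem[of "S \<union> X" K "UNIV :: ('f + 'r + nat) set" L] K inf
    by (auto simp: ordLeq_refl card_of_Card_order)
  then show ?thesis using \<open>C \<subseteq> S\<close> by (auto simp: small_model_def)
qed

text \<open>Otherwise dependent choice yields an infinite chain that is strict up to scaling, which shatters
  sets of every size.\<close>

lemma stable_small_model:
  assumes C: "|C| \<le>o |UNIV :: ('f + 'r + nat) set|"
    and \<kappa>: "|UNIV :: ('f + 'r + nat) set| <o \<kappa>" and sat: "saturated L K \<kappa>" and nip: "NIP L K"
  shows "\<exists>S. small_model S \<and> (\<forall>S'. small_model S' \<longrightarrow> S \<subseteq> S' \<longrightarrow>
     (\<exists>c. c \<noteq> 0 \<and> (\<forall>j\<in>infinitesimals (points S). c * j \<in> infinitesimals (points S'))))"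
proof (rule ccontr)
  assume neg: "\<not> ?thesis"
  define scaled where "scaled S S' \<longleftrightarrow>
    (\<exists>c. c \<noteq> 0 \<and> (\<forall>j\<in>infinitesimals (points S). c * j \<in> infinitesimals (points S')))" for S S'
  have "\<exists>f. \<forall>i::nat. small_model (f i) \<and> (f i \<subseteq> f (Suc i) \<and> \<not> scaled (f i) (f (Suc i)))"
  proof (rule dependent_nat_choice)
    show "\<exists>S. small_model S" using small_model_extend[of C "{}"] C by auto
    show "\<exists>S'. small_model S' \<and> (S \<subseteq> S' \<and> \<not> scaled S S')" if "small_model S" for S
      using neg that unfolding scaled_def[symmetric] by blast
  qed
  then obtain f where f: "\<And>i::nat. small_model (f i)" "\<And>i. f i \<subseteq> f (Suc i)"
    "\<And>i. \<not> scaled (f i) (f (Suc i))" by blast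
  have "subbasis (f i) (points (f i))" for i
    using f(1)[of i] ordLeq_ordLess_trans[OF _ \<kappa>] by (intro subbasis_points[OF _ _ sat]) (auto simp: small_model_def)
  moreover have "\<exists>j\<in>infinitesimals (points (f i)). c * j \<notin> infinitesimals (points (f (Suc i)))"
    if "c \<noteq> 0" for i c using f(3)[of i] that by (auto simp: scaled_def)
  ultimately have "shatters N" for N
    using points_mono[OF f(2)] by (intro chain_shatters[of f "\<lambda>i. points (f i)"])
  then show False using NIP_not_shatters[OF nip] by blast
qed

end

section \<open>Definable ring topologies on NIP fields\<close>

theorem theorem4p1:
  fixes L :: "('f, 'r) language"
    and K :: "('a :: field, 'f, 'r) struc"
    and plus_sym times_sym :: 'f
    and \<kappa> :: "'k rel"
    and \<tau> :: "'a topology"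
  assumes "Card_order \<kappa>"
    and "|UNIV :: ('f + 'r + nat) set| <o \<kappa>"
    and "expands_field L plus_sym times_sym K"
    and "saturated L K \<kappa>"
    and "NIP L K"
    and "ring_topology \<tau>"
    and "definable_topology L K \<tau>"
  shows "\<exists>R :: 'a set.
           is_subring R \<and> R \<noteq> UNIV \<and> frac_eq_UNIV R \<and>
           externally_definable L K 1 ((\<lambda>x. [x]) ` R) \<and>
           is_adic_topology R \<tau> \<and>
           (\<exists>K\<^sub>0. elementary_substruc L K\<^sub>0 K \<and> |univ K\<^sub>0| <o \<kappa> \<and> univ K\<^sub>0 \<subseteq> R)"
proof -
  let ?B = "UNIV :: ('f + 'r + nat) set"
  have K: "is_struc L K" "univ K = UNIV" using assms(3) by (simp_all add: expands_field_def)
  obtain \<B> where \<B>: "uniformly_definable_family L K \<B>" "openin \<tau> = arbitrary union_of (\<lambda>U. U \<in> \<B>)"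
    using assms(7) by (auto simp: definable_topology_def)
  obtain n Y0 Z where def: "definable L K n Y0" "definable L K (Suc n) Z"
    and \<B>': "\<B> = (\<lambda>ys. {x. x # ys \<in> Z}) ` Y0"
    using \<B>(1) unfolding uniformly_definable_family_def by blast
  define U where "U ys = {x. x # ys \<in> Z}" for ys
  \<comment> \<open>The basis of the topology becomes a basis at \<open>0\<close> by keeping the sets that contain \<open>0\<close>.\<close>
  define Y where "Y = {ys \<in> Y0. 0 \<in> U ys}"
  obtain eY :: "nat \<Rightarrow> 'a" where Y0: "Y0 \<subseteq> {xs. length xs = n}" "dpred L K (range eY) (\<lambda>e. tup n 0 e \<in> Y0)"
    by (rule dpred_definable[OF def(1) K(2)]) (rule that)
  obtain eZ :: "nat \<Rightarrow> 'a" where Z: "Z \<subseteq> {xs. length xs = Suc n}" "dpred L K (range eZ) (\<lambda>e. tup (Suc n) 0 e \<in> Z)"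
    by (rule dpred_definable[OF def(2) K(2)]) (rule that)
  have op: "openin \<tau> (U b) \<and> 0 \<in> U b" if "b \<in> Y" for b
  proof -
    have "U b \<in> \<B>" using that by (auto simp: Y_def \<B>' U_def)
    then have "openin \<tau> (U b)" unfolding \<B>(2) by (rule arbitrary_union_of_inc)
    then show ?thesis using that by (simp add: Y_def)
  qed
  have base: "\<exists>b\<in>Y. U b \<subseteq> W" if W: "openin \<tau> W" "0 \<in> W" for W
  proof -
    obtain \<U> where \<U>: "\<U> \<subseteq> \<B>" "W = \<Union>\<U>"
      using W(1) by (auto simp: \<B>(2) union_of_def)
    then obtain V where "V \<in> \<U>" "0 \<in> V" using W(2) by blast
    then show ?thesis using \<U> by (force simp: \<B>' Y_def U_def)
  qed
  interpret ring_nbhds Y U by (rule ring_topology_nbhds[OF assms(6) op base])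
  obtain b0 where b0: "b0 \<in> Y" "1 \<notin> U b0" using separated[of 1] by auto
  \<comment> \<open>All later models contain the parameters of the basis, and one neighbourhood that omits \<open>1\<close>.\<close>
  define C where "C = range eY \<union> range eZ \<union> ({0, -1} \<union> set b0)"
  interpret definable_nbhds Y U L K plus_sym times_sym C n
  proof
    show "expands_field L plus_sym times_sym K" by (rule assms(3))
    show "length b = n" if "b \<in> Y" for b using that Y0(1) by (auto simp: Y_def)
    show "-1 \<in> C" by (simp add: C_def)
    show "\<exists>b\<in>Y. set b \<subseteq> C \<and> 1 \<notin> U b" using b0 by (auto simp: C_def)
    have ZC: "dpred L K C (\<lambda>e. tup (Suc n) 0 e \<in> Z)"
      by (rule dpred_mono[OF Z(2)]) (auto simp: C_def)
    have tup_Suc: "tup (Suc n) 0 e = e 0 # tup n 1 e" for e :: "nat \<Rightarrow> 'a"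
      by (rule nth_equalityI) (auto simp: tup_def nth_Cons simp del: upt_Suc split: nat.split)
    show "dpred L K C (\<lambda>e. e 0 \<in> U (tup n 1 e))"
      using ZC by (simp add: U_def tup_Suc)
    define \<theta> :: "nat \<Rightarrow> nat + 'a" where "\<theta> i = (case i of 0 \<Rightarrow> Inr 0 | Suc k \<Rightarrow> Inl k)" for i
    have "range \<theta> \<subseteq> range Inl \<union> Inr ` C" by (auto simp: \<theta>_def C_def split: nat.splits)
    then have "dpred L K C (\<lambda>e. tup (Suc n) 0 (pval \<theta> e) \<in> Z)" by (rule dpred_subst[OF ZC])
    moreover have "tup (Suc n) 0 (pval \<theta> e) = 0 # tup n 0 e" for e
      unfolding tup_Suc by (simp add: tup_def pval_def \<theta>_def)
    ultimately have "dpred L K C (\<lambda>e. 0 \<in> U (tup n 0 e))" by (simp add: U_def)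
    moreover have "dpred L K C (\<lambda>e. tup n 0 e \<in> Y0)"
      by (rule dpred_mono[OF Y0(2)]) (auto simp: C_def)
    ultimately show "dpred L K C (\<lambda>e. tup n 0 e \<in> Y)"
      using dpred_conj by (simp add: Y_def)
  qed
  have inf: "infinite ?B" by simp
  have countable: "|range e| \<le>o |?B|" for e :: "nat \<Rightarrow> 'a"
    using card_of_image[of e UNIV] inf infinite_iff_card_of_nat ordLeq_transitive by metis
  have "|{0, -1} \<union> set b0| \<le>o |?B|" by (rule card_finite_le[OF inf]) simp
  then have C: "|C| \<le>o |?B|"
    unfolding C_def by (rule card_Un_le[OF inf card_Un_le[OF inf countable countable]])
  \<comment> \<open>A stable \<open>S\<close> is the only choice to be made: everything else holds over any small model.\<close>
  obtain S where S: "small_model S" and stable: "\<And>S'. small_model S' \<Longrightarrow> S \<subseteq> S' \<Longrightarrow>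
     \<exists>c. c \<noteq> 0 \<and> (\<forall>j\<in>infinitesimals (points S). c * j \<in> infinitesimals (points S'))"
    using stable_small_model[OF C assms(2,4,5)] by blast
  have tv: "tarski_vaught L K S" "C \<subseteq> S" and card: "|S| <o \<kappa>"
    using S ordLeq_ordLess_trans[OF _ assms(2)] by (auto simp: small_model_def)
  have sub: "subbasis S (points S)" by (rule subbasis_points[OF tv assms(4) card])
  let ?R = "stabilizer (points S)"
  have "is_adic_topology ?R \<tau>"
    unfolding is_adic_topology_def
  proof (intro conjI allI impI)
    show "ring_topology \<tau>" by (rule assms(6))
    fix I assume "is_ideal ?R I \<and> I \<noteq> {0}"
    then show "\<exists>V. openin \<tau> V \<and> 0 \<in> V \<and> V \<subseteq> I"
      using nbhd_in_ideal[OF sub, of I] op by blast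
  next
    fix V assume "openin \<tau> V \<and> 0 \<in> V"
    then obtain b where b: "b \<in> Y" "U b \<subseteq> V" using base by blast
    obtain S' where S': "small_model S'" "S \<union> set b \<subseteq> S'"
      using small_model_extend[OF _ C, of S "set b"] S by auto
    have "S \<subseteq> S'" using S'(2) by blast
    from stable[OF S'(1) this] obtain c
      where "c \<noteq> 0" "\<forall>j\<in>infinitesimals (points S). c * j \<in> infinitesimals (points S')"
      by (elim exE conjE)
    moreover have "b \<in> points S'" using b S' by (auto simp: points_def)
    moreover have "infinitesimals (points S') \<subseteq> infinitesimals (points S)"
      by (rule points_mono[OF \<open>S \<subseteq> S'\<close>])
    ultimately have "\<exists>I. is_ideal ?R I \<and> I \<noteq> {0} \<and> I \<subseteq> U b"
      by (intro ideal_in_nbhd[OF sub])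
    then show "\<exists>I. is_ideal ?R I \<and> I \<noteq> {0} \<and> I \<subseteq> V" using b(2) by blast
  qed
  moreover have "elementary_substruc L (K\<lparr>univ := S\<rparr>) K"
    by (rule tarski_vaught_elementary[OF K(1) tv(1)])
  ultimately show ?thesis
    using stabilizer_subring[OF sub] stabilizer_proper[OF sub] stabilizer_frac[OF sub]
      externally_definable_stabilizer[OF tv assms(4) card] card S_subset_stabilizer[OF sub]
    by (intro exI[of _ ?R] conjI exI[of _ "K\<lparr>univ := S\<rparr>"]) auto
qed

end
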